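(* The only angle $\theta\in(0,\pi/2)$ that gives rise to hierarchical tilings having both a finite number of orientations and a finite number of sizes of tiles is $\theta=\pi/4$. This is the case $\ln(\sin\theta)/\ln[(\cos\theta)/2]=1/3$.
   Context: Fix positive reals $a,b,c$ with $a^2+b^2=c^2$ and let $\theta=\arcsin(a/c)\in(0,\pi/2)$. A tile is a right triangle with an ordered triple of vertices $(A,C,B)$, with right angle at $C$ and angle $\theta$ at $A$, so that $|AC|:|CB|:|AB|=b:a:c$. $AC$ is called the long leg and $CB$ the short leg (even if $b\le a$). Subdivision rule: let $F$ be the foot of the perpendicular from $C$ to $AB$, and let $M,N,K$ be the midpoints of $AC$, $AF$, $FC$. The tile $(A,C,B)$ is divided into the five daughter tiles $(A,N,M)$, $(M,K,C)$, $(M,K,F)$, $(F,N,M)$ (each smaller than the parent by the linear factor $b/(2c)$) and $(C,F,B)$ (smaller by the linear factor $a/c$). Let $T$ be the basic tile with hypotenuse $c$. Put $T_0=\{T\}$, and for $n\ge1$ let $T_n$ be obtained from $T_{n-1}$ by subdividing every tile of $T_{n-1}$ that has the largest hypotenuse occurring in $T_{n-1}$. A supertile of order $n$ is a collection of tiles of the form $e(s(T_n))$, where $s$ is a rescaling and $e$ is a Euclidean motion (possibly orientation reversing). A hierarchical tiling with basic angle $\theta$ is a tiling of an infinite region (typically the whole plane) that is the union of supertiles $S_1\subsetneq S_2\subsetneq\cdots$ of orders $N_1<N_2<\cdots$, where for each $i$, writing $S_{i+1}=e(s(T_{N_{i+1}}))$, there are $n\le N_{i+1}$ and a tile $t\in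 T_n$ such that $S_i$ is the image under $e\circ s$ of the set of tiles of $T_{N_{i+1}}$ contained in $t$. The orientation of a tile is the element $g\in O(2)$ such that the tile is (respecting the vertex labels) a translate of a positive multiple of $g(T)$. The size of a tile is its hypotenuse length. "$\theta$ gives rise to" a property means that hierarchical tilings with basic angle $\theta$ have that property. *)

theory Defs
  imports "HOL-Analysis.Analysis"
begin

text \<open>The Euclidean plane is the type \<^typ>\<open>complex\<close>, used only as a real inner product space; O(2) is
  the set of its orthogonal transformations. A tile \<open>(A, C, B)\<close> is an ordered triple of vertices,
  with the right angle at the middle component; the labels matter even if the triangle is isosceles.\<close>

type_synonym tile = "complex \<times> complex \<times> complex"

fun tile_region :: "tile \<Rightarrow> complex set" where
  "tile_region (A, C, B) = convex hull {A, C, B}"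

fun tile_size :: "tile \<Rightarrow> real" where
  "tile_size (A, C, B) = dist A B"

fun map_tile :: "(complex \<Rightarrow> complex) \<Rightarrow> tile \<Rightarrow> tile" where
  "map_tile f (A, C, B) = (f A, f C, f B)"

text \<open>Legs \<open>|AC| = b\<close> and \<open>|CB| = a\<close>; the hypotenuse is \<open>sqrt (a\<^sup>2 + b\<^sup>2)\<close>.\<close>

definition basic_tile :: "real \<Rightarrow> real \<Rightarrow> tile" where
  "basic_tile a b = (0, Complex b 0, Complex b a)"

text \<open>Foot of the perpendicular from \<open>C\<close> to the line \<open>AB\<close>; see \<open>foot_on_line\<close> and
  \<open>foot_perpendicular\<close>.\<close>

definition foot :: "complex \<Rightarrow> complex \<Rightarrow> complex \<Rightarrow> complex" where
  "foot C A B = A + (((C - A) \<bullet> (B - A)) / ((B - A) \<bullet> (B - A))) *\<^sub>R (B - A)"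

lemma foot_on_line: "foot C A B \<in> affine hull {A, B}"
proof -
  have "foot C A B = (1 - r) *\<^sub>R A + r *\<^sub>R B"
    if "r = ((C - A) \<bullet> (B - A)) / ((B - A) \<bullet> (B - A))" for r
    unfolding foot_def that[symmetric] by (simp add: algebra_simps)
  then show ?thesis
    unfolding affine_hull_2 by (smt (verit) mem_Collect_eq)
qed

lemma foot_perpendicular: "A \<noteq> B \<Longrightarrow> (C - foot C A B) \<bullet> (B - A) = 0"
proof -
  assume "A \<noteq> B"
  then have "(B - A) \<bullet> (B - A) \<noteq> 0" by simp
  moreover have "(C - foot C A B) \<bullet> (B - A) =
      (C - A) \<bullet> (B - A) - (((C - A) \<bullet> (B - A)) / ((B - A) \<bullet> (B - A))) * ((B - A) \<bullet> (B - A))"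
    unfolding foot_def diff_add_eq_diff_diff_swap[symmetric]
    by (simp only: diff_diff_eq[symmetric] inner_diff_left[of "C - A"] inner_scaleR_left)
  ultimately show ?thesis by simp
qed

fun daughters :: "tile \<Rightarrow> tile set" where
  "daughters (A, C, B) =
    (let F = foot C A B; M = midpoint A C; N = midpoint A F; K = midpoint F C
     in {(A, N, M), (M, K, C), (M, K, F), (F, N, M), (C, F, B)})"

definition subdivide_largest :: "tile set \<Rightarrow> tile set" where
  "subdivide_largest X =
    (\<Union>t\<in>X. if \<forall>t'\<in>X. tile_size t' \<le> tile_size t then daughters t else {t})"

definition subdivision :: "real \<Rightarrow> real \<Rightarrow> nat \<Rightarrow> tile set" where
  "subdivision a b n = (subdivide_largest ^^ n) {basic_tile a b}"

definition rescaling :: "(complex \<Rightarrow> complex) \<Rightarrow> bool" where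
  "rescaling s \<longleftrightarrow> (\<exists>k>0. s = (\<lambda>x. k *\<^sub>R x))"

definition euclidean_motion :: "(complex \<Rightarrow> complex) \<Rightarrow> bool" where
  "euclidean_motion e \<longleftrightarrow> (\<exists>v g. orthogonal_transformation g \<and> e = (\<lambda>x. v + g x))"

definition supertile :: "real \<Rightarrow> real \<Rightarrow> nat \<Rightarrow> tile set \<Rightarrow> bool" where
  "supertile a b n S \<longleftrightarrow>
    (\<exists>e s. euclidean_motion e \<and> rescaling s \<and> S = map_tile (e \<circ> s) ` subdivision a b n)"

definition tiling_of_infinite_region :: "tile set \<Rightarrow> bool" where
  "tiling_of_infinite_region X \<longleftrightarrow>
    pairwise (\<lambda>t t'. interior (tile_region t) \<inter> interior (tile_region t') = {}) X \<and>
    \<not> bounded (\<Union>t\<in>X. tile_region t)"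

definition hierarchical_tiling :: "real \<Rightarrow> real \<Rightarrow> tile set \<Rightarrow> bool" where
  "hierarchical_tiling a b X \<longleftrightarrow>
    tiling_of_infinite_region X \<and>
    (\<exists>(S :: nat \<Rightarrow> tile set) (N :: nat \<Rightarrow> nat).
      X = (\<Union>i. S i) \<and>
      strict_mono N \<and>
      (\<forall>i. supertile a b (N i) (S i)) \<and>
      (\<forall>i. S i \<subset> S (Suc i)) \<and>
      (\<forall>i. \<exists>e s. euclidean_motion e \<and> rescaling s \<and>
        S (Suc i) = map_tile (e \<circ> s) ` subdivision a b (N (Suc i)) \<and>
        (\<exists>n\<le>N (Suc i). \<exists>t\<in>subdivision a b n.
          S i = map_tile (e \<circ> s) `
            {t' \<in> subdivision a b (N (Suc i)). tile_region t' \<subseteq> tile_region t})))"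

definition has_orientation :: "real \<Rightarrow> real \<Rightarrow> tile \<Rightarrow> (complex \<Rightarrow> complex) \<Rightarrow> bool" where
  "has_orientation a b t g \<longleftrightarrow>
    orthogonal_transformation g \<and>
    (\<exists>v. \<exists>k>0. t = map_tile (\<lambda>x. v + k *\<^sub>R g x) (basic_tile a b))"

definition finitely_many_orientations :: "real \<Rightarrow> real \<Rightarrow> tile set \<Rightarrow> bool" where
  "finitely_many_orientations a b X \<longleftrightarrow> finite {g. \<exists>t\<in>X. has_orientation a b t g}"

definition finitely_many_sizes :: "tile set \<Rightarrow> bool" where
  "finitely_many_sizes X \<longleftrightarrow> finite (tile_size ` X)"

text \<open>The basic angle \<open>\<theta>\<close> enters through the legs: \<open>a : b = sin \<theta> : cos \<theta>\<close>. Since supertiles may be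
  rescaled, the hierarchical tilings depend on \<open>a\<close> and \<open>b\<close> only through this ratio.\<close>

definition gives_rise_to :: "real \<Rightarrow> real \<Rightarrow> (tile set \<Rightarrow> bool) \<Rightarrow> bool" where
  "gives_rise_to a b P \<longleftrightarrow> (\<forall>X. hierarchical_tiling a b X \<longrightarrow> P X)"

end

theory Submission
  imports Defs "HOL-Computational_Algebra.Fundamental_Theorem_Algebra" "HOL-Library.Sublist"
begin

text \<open>Let \<open>\<rho> = b / (2 c)\<close> and \<open>\<sigma> = a / c\<close> be the two reduction factors. In a supertile of high order,
  a tile reached by \<open>j\<close> steps to \<open>(M, K, F)\<close> and then sufficiently many steps to \<open>(C, F, B)\<close> occurs
  for each small \<open>j\<close>. If the sizes are finitely many, two of these tiles have equal size, hence
  \<open>\<sigma> ^ q = \<rho> ^ p\<close> for some positive \<open>p, q\<close>; if the orientations are finitely many, two of them have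
  equal orientation, hence \<open>exp (i \<theta>)\<close> is a root of unity. Then \<open>t = 2 cos (2 \<theta>)\<close> is an algebraic
  integer all of whose conjugates lie in \<open>[-2, 2]\<close> and satisfy
  \<open>16 ^ p * (2 - t) ^ q = 4 ^ q * (2 + t) ^ p\<close>. By monotonicity this has a single solution in that
  interval, so \<open>t\<close> is rational, hence one of \<open>-1, 0, 1\<close>, and divisibility by \<open>3\<close> leaves \<open>t = 0\<close>.
  Conversely, for \<open>\<theta> = pi / 4\<close> we have \<open>\<rho> = \<sigma> ^ 3\<close>, so a supertile has at most three sizes, and its
  orientations lie in a coset of a dihedral group. Inflating the basic tile about \<open>A\<close> by \<open>1 / \<rho>\<close>
  yields a hierarchical tiling for every angle.\<close>

subsection \<open>Rational angles\<close>

abbreviation ipoly :: "int poly \<Rightarrow> 'a::{comm_ring_1,ring_char_0} \<Rightarrow> 'a" where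
  "ipoly p x \<equiv> poly (map_poly of_int p) x"

lemma ipoly_pCons: "ipoly (pCons k p) x = of_int k + x * ipoly p x"
  by (cases "k = 0 \<and> p = 0") (auto simp: map_poly_pCons)

lemma ipoly_add: "ipoly (p + q) x = ipoly p x + ipoly q x"
  by (induction p q rule: poly_induct2) (simp_all add: ipoly_pCons algebra_simps)

lemma ipoly_smult: "ipoly (smult k p) x = of_int k * ipoly p x"
  by (induction p) (simp_all add: ipoly_pCons algebra_simps)

lemma ipoly_diff: "ipoly (p - q) x = ipoly p x - ipoly q x"
  using ipoly_add[of p "- q" x] ipoly_smult[of "-1" q x] by simp

lemma ipoly_mult: "ipoly (p * q) x = ipoly p x * ipoly q x"
  by (induction p) (simp_all add: ipoly_pCons ipoly_add ipoly_smult algebra_simps)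

lemma ipoly_power: "ipoly (p ^ n) x = ipoly p x ^ n"
  by (induction n) (simp_all add: ipoly_mult)

lemma pderiv_map_poly_of_int:
  "pderiv (map_poly of_int p) = (map_poly of_int (pderiv p) :: 'a::{idom,ring_char_0} poly)"
  by (rule poly_eqI) (simp add: coeff_pderiv coeff_map_poly)

lemma degree_of_int_poly: "degree (map_poly of_int p :: 'a::{idom,ring_char_0} poly) = degree p"
  by (rule degree_map_poly) simp

text \<open>Among the nonzero integer polynomials vanishing at \<open>t\<close>, one of least degree
  divides \<open>P\<close> and \<open>Q\<close> up to an integer factor, so all its complex roots
  are common roots and equal \<open>t\<close>. A repeated root would make the derivative a smaller
  competitor, so the degree is 1.\<close>

lemma unique_common_root_rational:
  fixes t :: complex
  assumes "P \<noteq> 0" "ipoly P t = 0" "ipoly Q t = 0"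
    and unique: "\<And>z. ipoly P z = 0 \<Longrightarrow> ipoly Q z = 0 \<Longrightarrow> z = t"
  shows "t \<in> \<rat>"
proof -
  define V where "V g \<longleftrightarrow> g \<noteq> 0 \<and> ipoly g t = 0" for g
  obtain g where g: "V g" and least: "\<And>h. V h \<Longrightarrow> degree g \<le> degree h"
    using ex_has_least_nat[of V P degree] assms(1,2) unfolding V_def by blast
  have g0: "g \<noteq> 0" and gt: "ipoly g t = 0" using g by (auto simp: V_def)
  \<comment> \<open>Pseudo-division keeps the coefficients integral. Its remainder vanishes at
    \<open>t\<close> and has smaller degree than \<open>g\<close>, so minimality forces it to be
    0.\<close>
  have root: "ipoly R z = 0" if "ipoly R t = 0" "ipoly g z = 0" for R and z :: complex
  proof -
    obtain l q where lq: "l \<noteq> 0" "smult l R = g * q + pseudo_mod R g"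
      using pseudo_mod(1)[OF g0] by blast
    have E: "of_int l * ipoly R x = ipoly g x * ipoly q x + ipoly (pseudo_mod R g) x" for x :: complex
      using arg_cong[OF lq(2), of "\<lambda>p. ipoly p x"] by (simp add: ipoly_smult ipoly_mult ipoly_add)
    have "pseudo_mod R g = 0"
      using pseudo_mod(2)[OF g0, of R] least[of "pseudo_mod R g"] E[of t] that(1) gt
      by (force simp: V_def)
    then show ?thesis using E[of z] that(2) lq(1) by simp
  qed
  let ?G = "map_poly of_int g :: complex poly"
  have only: "z = t" if "ipoly g z = 0" for z :: complex
    using unique root assms(2,3) that by blast
  have "degree g \<noteq> 0"
    using gt g0 by (metis degree_eq_zeroE ipoly_pCons map_poly_0 mult_zero_right of_int_eq_0_iff
        pCons_0_0 poly_0 add_0_right)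
  moreover have "\<not> 2 \<le> degree g"
  proof
    assume d: "2 \<le> degree g"
    obtain H where H: "?G = [:-t, 1:] * H"
      using gt by (auto simp: poly_eq_0_iff_dvd dvd_def)
    have "H \<noteq> 0" using H d degree_of_int_poly[of g, where 'a=complex] by auto
    then have "degree ?G = 1 + degree H" unfolding H by (subst degree_mult_eq) auto
    then have "degree H \<noteq> 0" using d by (simp add: degree_of_int_poly)
    \<comment> \<open>A root of the cofactor \<open>H\<close> is again \<open>t\<close>, so
      \<open>t\<close> is a double root of \<open>g\<close> and a root of its derivative.\<close>
    then obtain z where z: "poly H z = 0"
      by (metis fundamental_theorem_of_algebra constant_degree)
    then have "z = t" using only[of z] H by simp
    with z have "poly (pderiv ?G) t = 0"
      unfolding H pderiv_mult poly_add poly_mult by (simp add: pderiv_pCons)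
    then have "V (pderiv g)"
      using d by (auto simp: V_def pderiv_map_poly_of_int pderiv_eq_0_iff)
    from least[OF this] show False using d by (simp add: degree_pderiv)
  qed
  ultimately have "degree g = 1" by simp
  then obtain u v where "g = [:u, v:]" "v \<noteq> 0" by (metis degree1_coeffs)
  with gt have "t = - of_int u / of_int v"
    by (simp add: ipoly_pCons field_simps eq_neg_iff_add_eq_0)
  then show ?thesis by simp
qed

text \<open>\<open>cheb n\<close> maps \<open>2 cos x\<close> to \<open>2 cos (n x)\<close>.\<close>

fun cheb :: "nat \<Rightarrow> int poly" where
  "cheb 0 = [:2:]"
| "cheb (Suc 0) = [:0, 1:]"
| "cheb (Suc (Suc n)) = [:0, 1:] * cheb (Suc n) - cheb n"

lemma ipoly_cheb: "z \<noteq> 0 \<Longrightarrow> ipoly (cheb n) (z + 1 / z) = z ^ n + 1 / z ^ n" for z :: complex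
proof (induction n rule: cheb.induct)
  case (3 n)
  then show ?case
    unfolding cheb.simps ipoly_diff ipoly_mult by (simp add: ipoly_pCons field_simps)
qed (simp_all add: ipoly_pCons)

text \<open>The index starts at 1, since \<open>cheb 0 = [:2:]\<close> is not monic. Monicity will
  make \<open>t\<close> an algebraic integer.\<close>

lemma degree_cheb: "degree (cheb (Suc n)) = Suc n \<and> lead_coeff (cheb (Suc n)) = 1"
proof (induction n rule: less_induct)
  case (less n)
  show ?case
  proof (cases n)
    case (Suc k)
    have 1: "degree (cheb (Suc k)) = Suc k" "lead_coeff (cheb (Suc k)) = 1"
      using less[of k] Suc by auto
    have 2: "degree (cheb k) < Suc (Suc k)"
      using less[of "k - 1"] Suc by (cases k) auto
    have "cheb (Suc k) \<noteq> 0" using 1 by auto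
    with 1 have "degree ([:0, 1:] * cheb (Suc k)) = Suc (Suc k)" by (subst degree_mult_eq) auto
    with 2 have "degree (cheb (Suc (Suc k))) = Suc (Suc k)"
      by (simp only: cheb.simps diff_conv_add_uminus degree_minus degree_add_eq_left)
    moreover have "coeff (cheb (Suc (Suc k))) (Suc (Suc k)) = 1"
      using 1 2 by (simp add: coeff_eq_0)
    ultimately show ?thesis using Suc by simp
  qed auto
qed

lemma degree_cheb_minus_2:
  assumes "m > 0"
  shows "degree (cheb m - [:2:]) = m \<and> lead_coeff (cheb m - [:2:]) = 1"
proof -
  obtain n where [simp]: "m = Suc n" using assms by (cases m) auto
  have "degree (cheb m - [:2:]) = m"
    using degree_cheb[of n] unfolding diff_conv_add_uminus by (subst degree_add_eq_left) auto
  then show ?thesis using degree_cheb[of n] by (simp del: cheb.simps) (metis degree_cheb)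
qed

text \<open>If \<open>w\<close> is a root of unity, \<open>2 Re (w\<^sup>2)\<close> and all its conjugates lie in \<open>[-2, 2]\<close>; the
  relation between the ratios is a polynomial equation with only one solution in that interval.\<close>

lemma isosceles_if_commensurable:
  fixes \<rho> \<sigma> :: real and w :: complex
  assumes pos: "\<rho> > 0" "\<sigma> > 0" and pyth: "\<sigma>\<^sup>2 + 4 * \<rho>\<^sup>2 = 1"
    and pq: "p > 0" "q > 0" "\<sigma> ^ q = \<rho> ^ p"
    and w: "w = Complex (2 * \<rho>) \<sigma>" "m > 0" "w ^ m = 1"
  shows "\<sigma> = 2 * \<rho>"
proof -
  \<comment> \<open>For \<open>w = exp (i \<theta>)\<close> this is
    \<open>2 * cos (2 * \<theta>)\<close>.\<close>
  define t where "t = 2 - 4 * \<sigma>\<^sup>2"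
  have t': "t = 16 * \<rho>\<^sup>2 - 2" using pyth by (simp add: t_def)
  have t_bounds: "-2 < t" "t < 2" using t_def t' pos zero_less_power[of \<sigma> 2] zero_less_power[of \<rho> 2] by linarith+
  \<comment> \<open>\<open>P\<close> is the square of the relation
    \<open>\<sigma> ^ q = \<rho> ^ p\<close>, rewritten with
    \<open>4 * \<sigma>\<^sup>2 = 2 - t\<close> and \<open>16 * \<rho>\<^sup>2 = 2 + t\<close>;
    \<open>Q\<close> vanishes at \<open>z + 1 / z\<close> whenever \<open>z ^ m = 1\<close>.\<close>
  define P :: "int poly" where "P = smult (16 ^ p) ([:2, -1:] ^ q) - smult (4 ^ q) ([:2, 1:] ^ p)"
  define Q :: "int poly" where "Q = cheb m - [:2:]"
  have P: "ipoly P x = 16 ^ p * (2 - x) ^ q - 4 ^ q * (2 + x) ^ p" for x :: complex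
    by (simp add: P_def ipoly_diff ipoly_smult ipoly_power ipoly_pCons)
  have eq: "16 ^ p * (2 - t) ^ q = 4 ^ q * (2 + t) ^ p"
  proof -
    have "(\<sigma>\<^sup>2) ^ q = (\<rho>\<^sup>2) ^ p" using pq(3) by (metis power_commutes power_even_eq power_mult mult.commute)
    moreover have "2 - t = 4 * \<sigma>\<^sup>2" "2 + t = 16 * \<rho>\<^sup>2" using t_def t' by auto
    ultimately show ?thesis by (simp add: power_mult_distrib)
  qed
  \<comment> \<open>On \<open>[-2, 2]\<close> the left side strictly decreases and the right side
    strictly increases, so they meet at most once.\<close>
  have mono: "\<not> x < y" if "16 ^ p * (2 - x) ^ q = 4 ^ q * (2 + x) ^ p"
    "16 ^ p * (2 - y) ^ q = 4 ^ q * (2 + y) ^ p" "-2 \<le> x" "y \<le> 2" for x y :: real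
  proof
    assume "x < y"
    then have "(2 - y) ^ q < (2 - x) ^ q" "(2 + x) ^ p < (2 + y) ^ p"
      using that pq by (auto intro!: power_strict_mono)
    then have "16 ^ p * (2 - y) ^ q < 16 ^ p * (2 - x) ^ q" "4 ^ q * (2 + x) ^ p < 4 ^ q * (2 + y) ^ p"
      by auto
    then show False using that by linarith
  qed
  have only_real: "x = t" if "16 ^ p * (2 - x) ^ q = 4 ^ q * (2 + x) ^ p" "-2 \<le> x" "x \<le> 2" for x
    using mono[OF that(1) eq] mono[OF eq that(1)] that t_bounds by force
  have Pt: "ipoly P (complex_of_real t) = 0"
  proof -
    have "ipoly P (complex_of_real t) =
        complex_of_real (16 ^ p * (2 - t) ^ q - 4 ^ q * (2 + t) ^ p)"
      unfolding P by simp
    then show ?thesis using eq by simp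
  qed
  have w0: "w \<noteq> 0" using w(1) pos by (auto simp: complex_eq_iff)
  have norm_w: "w * cnj w = 1"
    using pyth unfolding w(1) by (simp add: complex_eq_iff power2_eq_square)
  have tw: "complex_of_real t = w\<^sup>2 + 1 / w\<^sup>2"
  proof -
    have "1 / w = cnj w" using norm_w w0 by (simp add: field_simps)
    then have "1 / w\<^sup>2 = (cnj w)\<^sup>2" by (metis power_one_over)
    then show ?thesis
      using pyth unfolding w(1) t_def by (simp add: complex_eq_iff power2_eq_square)
  qed
  have Qt: "ipoly Q (complex_of_real t) = 0"
  proof -
    have "(w\<^sup>2) ^ m = 1" by (metis w(3) power_mult mult.commute power_one)
    then show ?thesis
      unfolding Q_def ipoly_diff tw using ipoly_cheb[of "w\<^sup>2" m] w0 by (simp add: ipoly_pCons)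
  qed
  have only: "x = complex_of_real t" if "ipoly P x = 0" "ipoly Q x = 0" for x
  proof -
    \<comment> \<open>Every complex number has the form \<open>z + 1 / z\<close>. The polynomial
      \<open>Q\<close> then forces \<open>z ^ m = 1\<close>, hence \<open>norm z = 1\<close>, and
      \<open>x = 2 * Re z\<close> is real in \<open>[-2, 2]\<close>.\<close>
    obtain z where z: "z * z - x * z + 1 = 0"
    proof -
      let ?d = "csqrt (x\<^sup>2 - 4)"
      have "?d * ?d = x\<^sup>2 - 4" by (simp add: power2_eq_square[symmetric])
      moreover have "((x + ?d) / 2) * ((x + ?d) / 2) - x * ((x + ?d) / 2) + 1 =
          (?d * ?d - x\<^sup>2 + 4) / 4"
        by (simp add: field_simps power2_eq_square)
      ultimately have "((x + ?d) / 2) * ((x + ?d) / 2) - x * ((x + ?d) / 2) + 1 = 0"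
        by simp
      then show ?thesis by (rule that)
    qed
    have z0: "z \<noteq> 0" using z by auto
    have xz: "x = z + 1 / z" using z z0 by (simp add: field_simps)
    have "z ^ m + 1 / z ^ m = 2"
      using that(2) ipoly_cheb[OF z0, of m] by (simp add: Q_def ipoly_diff ipoly_pCons xz)
    then have "(z ^ m - 1)\<^sup>2 = 0" using z0 by (simp add: field_simps power2_eq_square)
    then have "z ^ m = 1" by simp
    then have "norm z ^ m = 1" by (metis norm_one norm_power)
    then have nz: "norm z = 1" using w(2) power_eq_imp_eq_base[of "norm z" m 1] by simp
    then have "z * cnj z = 1" using complex_norm_square[of z] by simp
    then have "1 / z = cnj z" using z0 by (simp add: field_simps)
    then have xr: "x = complex_of_real (2 * Re z)" using xz by (simp add: complex_eq_iff)
    have "complex_of_real (16 ^ p * (2 - 2 * Re z) ^ q - 4 ^ q * (2 + 2 * Re z) ^ p) = 0"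
      using that(1) unfolding P xr by simp
    then have "16 ^ p * (2 - 2 * Re z) ^ q = 4 ^ q * (2 + 2 * Re z) ^ p"
      by (simp only: of_real_eq_0_iff)
    moreover have "\<bar>Re z\<bar> \<le> 1" using abs_Re_le_cmod[of z] nz by simp
    ultimately have "2 * Re z = t" by (intro only_real) auto
    then show ?thesis using xr by simp
  qed
  \<comment> \<open>At 2 the first summand of \<open>P\<close> vanishes because
    \<open>q > 0\<close>, while the second is a product of powers of 4.\<close>
  have "P \<noteq> 0"
  proof
    assume "P = 0"
    then have "ipoly P (2::complex) = 0" by simp
    then show False using pq unfolding P by (simp add: power_0_left)
  qed
  from unique_common_root_rational[OF this Pt Qt only] have "complex_of_real t \<in> \<rat>" .
  moreover have "algebraic_int (complex_of_real t)"
    unfolding algebraic_int_altdef_ipoly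
    using Qt[unfolded Q_def] degree_cheb_minus_2[OF w(2), THEN conjunct2] by (intro exI conjI)
  ultimately have "complex_of_real t \<in> \<int>" by (intro rational_algebraic_int_is_int)
  then obtain k where "complex_of_real t = of_int k" by (auto elim: Ints_cases)
  then have tk: "t = of_int k" by (metis of_real_eq_iff of_real_of_int_eq)
  then have "k \<in> {-1, 0, 1}" using t_bounds by auto
  \<comment> \<open>For \<open>t = 1\<close> and \<open>t = -1\<close>, one side of
    \<open>eq\<close> has a factor 3, as \<open>p\<close> and \<open>q\<close> are positive, and the
    other is a power of 2.\<close>
  moreover have "k \<noteq> 1"
  proof
    assume "k = 1"
    then have "real (16 ^ p) = real (4 ^ q * 3 ^ p)" using eq tk by simp
    then have "16 ^ p = 4 ^ q * (3::nat) ^ p" by (simp only: of_nat_eq_iff)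
    moreover have "3 dvd (3::nat) ^ p" using pq(1) by (intro dvd_power) auto
    ultimately have "3 dvd (16::nat) ^ p" by simp
    then have "3 dvd (16::nat)" by (rule prime_dvd_power[rotated]) simp
    then show False by simp
  qed
  moreover have "k \<noteq> -1"
  proof
    assume "k = -1"
    then have "real (4 ^ q) = real (16 ^ p * 3 ^ q)" using eq tk by simp
    then have "4 ^ q = 16 ^ p * (3::nat) ^ q" by (simp only: of_nat_eq_iff)
    moreover have "3 dvd (3::nat) ^ q" using pq(2) by (intro dvd_power) auto
    ultimately have "3 dvd (4::nat) ^ q" by simp
    then have "3 dvd (4::nat)" by (rule prime_dvd_power[rotated]) simp
    then show False by simp
  qed
  ultimately have "t = 0" using tk by auto
  then have "\<sigma>\<^sup>2 = (2 * \<rho>)\<^sup>2" using t_def t' by (simp add: power_mult_distrib)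
  then show ?thesis by (rule power2_eq_imp_eq) (use pos in auto)
qed

subsection \<open>Similarities\<close>

definition similarity :: "(complex \<Rightarrow> complex) \<Rightarrow> bool" where
  "similarity f \<longleftrightarrow>
    (\<exists>u k g. k > 0 \<and> orthogonal_transformation g \<and> f = (\<lambda>x. u + k *\<^sub>R g x))"

lemma similarityI:
  "k > 0 \<Longrightarrow> orthogonal_transformation g \<Longrightarrow> similarity (\<lambda>x. u + k *\<^sub>R g x)"
  unfolding similarity_def by blast

lemma similarity_id: "similarity id"
  using similarityI[of 1 id 0] by (simp add: orthogonal_transformation_def linear_id id_def)

lemma similarity_compose:
  assumes "similarity f" "similarity g"
  shows "similarity (f \<circ> g)"
proof -
  obtain u k p v l q where f: "k > 0" "orthogonal_transformation p" "f = (\<lambda>x. u + k *\<^sub>R p x)"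
    and g: "l > 0" "orthogonal_transformation q" "g = (\<lambda>x. v + l *\<^sub>R q x)"
    using assms unfolding similarity_def by metis
  have "f \<circ> g = (\<lambda>x. (u + k *\<^sub>R p v) + (k * l) *\<^sub>R (p \<circ> q) x)"
    using f(2) unfolding f(3) g(3)
    by (auto simp: fun_eq_iff orthogonal_transformation_def linear_add linear_scale algebra_simps)
  moreover have "orthogonal_transformation (p \<circ> q)"
    using f(2) g(2) by (rule orthogonal_transformation_compose)
  ultimately show ?thesis using f(1) g(1)
    similarityI[of "k * l" "p \<circ> q" "u + k *\<^sub>R p v"] by simp
qed

lemma similarity_funpow: "similarity f \<Longrightarrow> similarity (f ^^ n)"
  by (induction n) (auto intro: similarity_compose similarity_id)

text \<open>Lets the two-stage maps \<open>e \<circ> s\<close> of supertiles and hierarchical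
  tilings be handled as single maps that are closed under composition.\<close>

lemma similarity_iff_motion_rescaling:
  "similarity f \<longleftrightarrow> (\<exists>e s. euclidean_motion e \<and> rescaling s \<and> f = e \<circ> s)"
proof
  assume "similarity f"
  then obtain u k g where f: "k > 0" "orthogonal_transformation g" "f = (\<lambda>x. u + k *\<^sub>R g x)"
    unfolding similarity_def by blast
  then have "f = (\<lambda>x. u + g x) \<circ> (\<lambda>x. k *\<^sub>R x)"
    by (auto simp: orthogonal_transformation_def linear_scale)
  then show "\<exists>e s. euclidean_motion e \<and> rescaling s \<and> f = e \<circ> s"
    using f(1,2) unfolding euclidean_motion_def rescaling_def by blast
next
  assume "\<exists>e s. euclidean_motion e \<and> rescaling s \<and> f = e \<circ> s"
  then obtain u g k where "orthogonal_transformation g" "k > 0"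
    "f = (\<lambda>x. u + g x) \<circ> (\<lambda>x. k *\<^sub>R x)"
    unfolding euclidean_motion_def rescaling_def by blast
  then show "similarity f"
    by (auto simp: orthogonal_transformation_def linear_scale o_def intro!: similarityI)
qed

lemma similarity_inj: "similarity f \<Longrightarrow> inj f"
  by (clarsimp simp: similarity_def inj_def orthogonal_transformation_inj[unfolded inj_def])

lemma similarity_midpoint:
  assumes "similarity f"
  shows "f (midpoint x y) = midpoint (f x) (f y)"
proof -
  obtain u k g where "orthogonal_transformation g" and f: "f = (\<lambda>x. u + k *\<^sub>R g x)"
    using assms unfolding similarity_def by blast
  then have "linear g" by (simp add: orthogonal_transformation_def)
  then show ?thesis
    unfolding f midpoint_def
    by (simp add: linear_add linear_scale complex_eq_iff field_simps)
qed

text \<open>The coefficient in \<open>foot\<close> is a quotient of inner products, and a similarity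
  multiplies both by the same \<open>k\<^sup>2\<close>.\<close>

lemma similarity_foot:
  assumes "similarity f"
  shows "f (foot C A B) = foot (f C) (f A) (f B)"
proof -
  obtain u k g where k: "k > 0" and g: "orthogonal_transformation g" and f: "f = (\<lambda>x. u + k *\<^sub>R g x)"
    using assms unfolding similarity_def by blast
  have lin: "linear g" using g by (simp add: orthogonal_transformation_def)
  have diff: "f x - f y = k *\<^sub>R g (x - y)" for x y
    unfolding f by (simp add: linear_diff[OF lin] algebra_simps)
  have inner: "(f x - f y) \<bullet> (f x' - f y') = k\<^sup>2 * ((x - y) \<bullet> (x' - y'))" for x y x' y'
    using g unfolding diff by (simp add: orthogonal_transformation_def power2_eq_square)
  have "f (A + r *\<^sub>R (B - A)) = f A + r *\<^sub>R (f B - f A)" for r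
    unfolding diff unfolding f by (simp add: linear_add[OF lin] linear_scale[OF lin] scaleR_add_right)
  then show ?thesis
    using k unfolding foot_def inner by simp
qed

lemma map_tile_comp: "map_tile f (map_tile g t) = map_tile (f \<circ> g) t"
  by (cases t) simp

lemma inj_map_tile: "inj f \<Longrightarrow> inj (map_tile f)"
  by (auto simp: inj_def)

lemma map_tile_id [simp]: "map_tile id t = t"
  by (cases t) simp

lemma daughters_map_tile:
  assumes "similarity f"
  shows "daughters (map_tile f t) = map_tile f ` daughters t"
  by (cases t) (simp add: Let_def similarity_midpoint[OF assms] similarity_foot[OF assms])

lemma tile_region_map_tile:
  assumes "similarity f"
  shows "tile_region (map_tile f t) = f ` tile_region t"
proof -
  obtain u k g where f: "orthogonal_transformation g" "f = (\<lambda>x. u + k *\<^sub>R g x)"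
    using assms unfolding similarity_def by blast
  have lin: "linear (\<lambda>x. k *\<^sub>R g x)"
    using f(1) by (simp add: orthogonal_transformation_def linear_compose_scale_right)
  obtain A C B where t: "t = (A, C, B)" by (metis prod_cases3)
  have "convex hull {f A, f C, f B} = convex hull ((+) u ` (\<lambda>x. k *\<^sub>R g x) ` {A, C, B})"
    by (simp add: f(2))
  also have "\<dots> = f ` (convex hull {A, C, B})"
    unfolding convex_hull_translation convex_hull_linear_image[OF lin, symmetric] f(2)
    by (simp add: image_image)
  finally show ?thesis by (simp add: t)
qed

lemma interior_similarity:
  assumes "similarity f"
  shows "interior (f ` S) = f ` interior S"
proof -
  obtain u k g where f: "k > 0" "orthogonal_transformation g" "f = (\<lambda>x. u + k *\<^sub>R g x)"
    using assms unfolding similarity_def by blast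
  have lin: "linear (\<lambda>x. k *\<^sub>R g x)"
    using f(2) by (simp add: orthogonal_transformation_def linear_compose_scale_right)
  have inj: "inj (\<lambda>x. k *\<^sub>R g x)"
    using f(1) orthogonal_transformation_inj[OF f(2)] by (simp add: inj_on_def)
  have "f ` X = (+) u ` (\<lambda>x. k *\<^sub>R g x) ` X" for X
    by (simp add: f(3) image_image)
  then show ?thesis
    by (simp add: interior_translation interior_injective_linear_image[OF lin inj])
qed

lemma orthogonal_transformation_mult:
  assumes "norm v = 1"
  shows "orthogonal_transformation (\<lambda>x. v * x)" "orthogonal_transformation (\<lambda>x. v * cnj x)"
proof -
  have "orthogonal_transformation (\<lambda>x. v * x)"
    unfolding orthogonal_transformation using assms
    by (auto simp: norm_mult intro!: linearI simp: algebra_simps)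
  moreover have "orthogonal_transformation cnj"
    unfolding orthogonal_transformation by (auto intro!: linearI)
  ultimately show "orthogonal_transformation (\<lambda>x. v * x)" "orthogonal_transformation (\<lambda>x. v * cnj x)"
    using orthogonal_transformation_compose[of "\<lambda>x. v * x" cnj] by (auto simp: o_def)
qed

text \<open>Any \<open>K + 1\<close> elements of the union would already lie in one member of the
  chain. This passes uniform bounds for supertiles to the whole tiling.\<close>

lemma finite_UN_if_card_bounded:
  fixes A :: "nat \<Rightarrow> 'a set"
  assumes "mono A" and fin: "\<And>i. finite (A i) \<and> card (A i) \<le> K"
  shows "finite (\<Union>i. A i)"
proof (rule ccontr)
  assume "infinite (\<Union>i. A i)"
  then obtain F where F: "card F = Suc K" "finite F" "F \<subseteq> (\<Union>i. A i)"
    using infinite_arbitrarily_large by blast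
  have "\<exists>i. F \<subseteq> A i"
    using F(2,3)
  proof (induction F)
    case (insert x F)
    then obtain i j where "F \<subseteq> A i" "x \<in> A j" by auto
    then have "insert x F \<subseteq> A (max i j)"
      using monoD[OF assms(1), of i "max i j"] monoD[OF assms(1), of j "max i j"] by auto
    then show ?case ..
  qed auto
  then obtain i where "F \<subseteq> A i" ..
  with fin[of i] have "card F \<le> K" by (meson card_mono le_trans)
  then show False using F(1) by simp
qed

subsection \<open>Words of daughters\<close>

datatype daughter = ANM | MKC | MKF | FNM | CFB

lemma UNIV_daughter: "UNIV = {ANM, MKC, MKF, FNM, CFB}"
  using daughter.exhaust by auto

lemma finite_daughter: "finite (UNIV :: daughter set)"
  by (simp add: UNIV_daughter)

locale right_triangle =
  fixes a b c :: real
  assumes pos: "a > 0" "b > 0" "c > 0" and pyth: "a\<^sup>2 + b\<^sup>2 = c\<^sup>2"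
begin

definition \<rho> :: real where "\<rho> = b / (2 * c)"
definition \<sigma> :: real where "\<sigma> = a / c"
definition dir :: complex where "dir = Complex (b / c) (a / c)"

definition foot_of_T :: complex where
  "foot_of_T = Complex (b ^ 3 / c\<^sup>2) (a * b\<^sup>2 / c\<^sup>2)"

abbreviation T :: tile where "T \<equiv> basic_tile a b"

fun ratio :: "daughter \<Rightarrow> real" where
  "ratio CFB = \<sigma>"
| "ratio _ = \<rho>"

text \<open>Linear part of the similarity from \<open>T\<close> to the daughter, with
  \<open>corner\<close> as the image of the vertex 0. A conjugation marks a reversed
  orientation.\<close>

fun turn :: "daughter \<Rightarrow> complex \<Rightarrow> complex" where
  "turn ANM = (\<lambda>x. dir * cnj x)"
| "turn MKC = (\<lambda>x. dir * cnj x)"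
| "turn MKF = (\<lambda>x. dir * x)"
| "turn FNM = (\<lambda>x. - (dir * x))"
| "turn CFB = (\<lambda>x. \<i> * dir * cnj x)"

fun corner :: "daughter \<Rightarrow> complex" where
  "corner ANM = 0"
| "corner MKC = Complex (b / 2) 0"
| "corner MKF = Complex (b / 2) 0"
| "corner FNM = foot_of_T"
| "corner CFB = Complex b 0"

definition place :: "daughter \<Rightarrow> complex \<Rightarrow> complex" where
  "place d x = corner d + ratio d *\<^sub>R turn d x"

definition size_of :: "daughter list \<Rightarrow> real" where
  "size_of w = prod_list (map ratio w)"

primrec rot :: "daughter list \<Rightarrow> complex \<Rightarrow> complex" where
  "rot [] = id"
| "rot (d # w) = turn d \<circ> rot w"

text \<open>The first letter acts last, so a word is an address read from the root: appending a
  letter passes to a daughter, and the head names the daughter of \<open>T\<close> that contains the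
  tile.\<close>

primrec place_word :: "daughter list \<Rightarrow> complex \<Rightarrow> complex" where
  "place_word [] = id"
| "place_word (d # w) = place d \<circ> place_word w"

definition tile :: "daughter list \<Rightarrow> tile" where
  "tile w = map_tile (place_word w) T"

lemma \<rho>_pos: "\<rho> > 0" and \<sigma>_pos: "\<sigma> > 0"
  using pos by (auto simp: \<rho>_def \<sigma>_def)

lemma \<sigma>_\<rho>: "\<sigma>\<^sup>2 + 4 * \<rho>\<^sup>2 = 1"
  using pos pyth by (simp add: \<rho>_def \<sigma>_def power_divide power_mult_distrib add_divide_distrib[symmetric])

lemma \<rho>_less_1: "\<rho> < 1" and \<sigma>_less_1: "\<sigma> < 1"
proof -
  have "\<rho>\<^sup>2 < 1\<^sup>2" "\<sigma>\<^sup>2 < 1\<^sup>2" unfolding power_one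
    using \<sigma>_\<rho> zero_less_power[OF \<rho>_pos, of 2] zero_less_power[OF \<sigma>_pos, of 2] by linarith+
  then show "\<rho> < 1" "\<sigma> < 1" by (metis power_less_imp_less_base zero_le_one)+
qed

lemma norm_dir: "norm dir = 1"
  using pos pyth by (simp add: dir_def cmod_def power_divide add_divide_distrib[symmetric] add.commute)

lemma ratio_pos: "ratio d > 0" and ratio_less_1: "ratio d < 1"
  using \<rho>_pos \<sigma>_pos \<rho>_less_1 \<sigma>_less_1 by (cases d; simp)+

lemma orthogonal_turn: "orthogonal_transformation (turn d)"
  using orthogonal_transformation_mult[of dir] orthogonal_transformation_mult[of "- dir"]
    orthogonal_transformation_mult[of "\<i> * dir"] norm_dir
  by (cases d) (simp_all add: norm_mult)

lemma similarity_place: "similarity (place d)"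
  using similarityI[OF ratio_pos[of d] orthogonal_turn[of d], of "corner d"]
  unfolding place_def[abs_def] .

lemma similarity_place_word: "similarity (place_word w)"
proof (induction w)
  case Nil
  show ?case unfolding place_word.simps by (rule similarity_id)
next
  case (Cons d w)
  then show ?case unfolding place_word.simps by (rule similarity_compose[OF similarity_place])
qed

lemma size_of_simps [simp]: "size_of [] = 1" "size_of (d # w) = ratio d * size_of w"
  by (simp_all add: size_of_def)

lemma size_of_append [simp]: "size_of (v @ w) = size_of v * size_of w"
  by (simp add: size_of_def)

lemma size_of_pos: "size_of w > 0"
  by (induction w) (auto simp: ratio_pos)

lemma size_of_le_1: "size_of w \<le> 1"
proof (induction w)
  case (Cons d w)
  then show ?case
    using mult_mono[of "ratio d" 1 "size_of w" 1] ratio_less_1[of d] size_of_pos[of w] by simp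
qed simp

lemma not_less_size_of: "\<not> 1 < size_of w"
  using size_of_le_1[of w] by simp

lemma rot_append: "rot (v @ w) = rot v \<circ> rot w"
  by (induction v) auto

lemma place_word_append: "place_word (v @ w) = place_word v \<circ> place_word w"
  by (induction v) auto

lemma orthogonal_rot: "orthogonal_transformation (rot w)"
proof (induction w)
  case Nil
  show ?case unfolding rot.simps by (simp add: orthogonal_transformation_def linear_id)
next
  case (Cons d w)
  then show ?case
    unfolding rot.simps by (rule orthogonal_transformation_compose[OF orthogonal_turn])
qed

lemma place_word_eq: "\<exists>u. place_word w = (\<lambda>x. u + size_of w *\<^sub>R rot w x)"
proof (induction w)
  case Nil
  show ?case by (intro exI[of _ 0]) auto
next
  case (Cons d w)
  then obtain u where u: "place_word w = (\<lambda>x. u + size_of w *\<^sub>R rot w x)" by blast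
  have lin: "linear (turn d)" using orthogonal_turn by (simp add: orthogonal_transformation_def)
  show ?case
    by (intro exI[of _ "corner d + ratio d *\<^sub>R turn d u"])
      (simp add: u place_def fun_eq_iff linear_add[OF lin] linear_scale[OF lin] scaleR_add_right)
qed

lemma tile_append: "tile (v @ w) = map_tile (place_word v) (tile w)"
  by (simp add: tile_def place_word_append map_tile_comp)

lemma tile_Nil [simp]: "tile [] = T"
  by (simp add: tile_def)

lemma tile_Cons: "tile (d # w) = map_tile (place d) (tile w)"
  by (simp add: tile_def map_tile_comp)

section \<open>The five daughters as similar copies of the basic tile\<close>

lemma foot_basic_tile: "foot (Complex b 0) 0 (Complex b a) = foot_of_T"
proof -
  have "Complex b a \<bullet> Complex b a = c\<^sup>2"
    using pyth by (simp add: inner_complex_def power2_eq_square add.commute)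
  then show ?thesis
    unfolding foot_def foot_of_T_def
    by (simp add: inner_complex_def complex_eq_iff power2_eq_square power3_eq_cube)
qed

text \<open>Checks by coordinates, vertex label by vertex label, that \<open>corner\<close>,
  \<open>ratio\<close> and \<open>turn\<close> describe the five daughters.\<close>

lemma tile_singleton:
  "tile [ANM] = (0, midpoint 0 foot_of_T, midpoint 0 (Complex b 0))"
  "tile [MKC] = (midpoint 0 (Complex b 0), midpoint foot_of_T (Complex b 0), Complex b 0)"
  "tile [MKF] = (midpoint 0 (Complex b 0), midpoint foot_of_T (Complex b 0), foot_of_T)"
  "tile [FNM] = (foot_of_T, midpoint 0 foot_of_T, midpoint 0 (Complex b 0))"
  "tile [CFB] = (Complex b 0, foot_of_T, Complex b a)"
proof -
  have c0: "c \<noteq> 0" and aa: "a * a = c * c - b * b"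
    using pos pyth by (auto simp: power2_eq_square)
  note simps = tile_def place_def basic_tile_def midpoint_def foot_of_T_def dir_def \<rho>_def \<sigma>_def
    complex_eq_iff power2_eq_square power3_eq_cube
  have aa': "a * (a * x) = c * (c * x) - b * (b * x)" for x
    using aa by (metis left_diff_distrib mult.assoc)
  show "tile [ANM] = (0, midpoint 0 foot_of_T, midpoint 0 (Complex b 0))"
    "tile [MKC] = (midpoint 0 (Complex b 0), midpoint foot_of_T (Complex b 0), Complex b 0)"
    "tile [MKF] = (midpoint 0 (Complex b 0), midpoint foot_of_T (Complex b 0), foot_of_T)"
    "tile [FNM] = (foot_of_T, midpoint 0 foot_of_T, midpoint 0 (Complex b 0))"
    "tile [CFB] = (Complex b 0, foot_of_T, Complex b a)"
    using c0 by (simp_all add: simps divide_simps aa aa' algebra_simps)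
qed

lemma daughters_tile: "daughters (tile w) = range (\<lambda>d. tile (w @ [d]))"
proof -
  have "daughters T = range (\<lambda>d. tile [d])"
    unfolding UNIV_daughter
    by (simp add: tile_singleton Let_def foot_basic_tile basic_tile_def del: tile_Nil)
  then have "daughters (tile w) = map_tile (place_word w) ` range (\<lambda>d. tile [d])"
    unfolding tile_def[of w] by (simp add: daughters_map_tile similarity_place_word)
  then show ?thesis by (simp add: tile_append image_image)
qed

lemma tile_size_tile:
  assumes "k > 0" "orthogonal_transformation g"
  shows "tile_size (map_tile (\<lambda>x. u + k *\<^sub>R g x) (tile w)) = k * c * size_of w"
proof -
  obtain v where v: "place_word w = (\<lambda>x. v + size_of w *\<^sub>R rot w x)"
    using place_word_eq by blast
  have lin: "linear g" "linear (rot w)"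
    using assms orthogonal_rot[of w] by (auto simp: orthogonal_transformation_def)
  have "norm (Complex b a) = c"
    using pyth pos by (simp add: cmod_def add.commute)
  then show ?thesis
    using assms size_of_pos[of w] orthogonal_rot[of w]
    by (simp add: tile_def basic_tile_def v dist_norm linear_0[OF lin(2)] linear_add[OF lin(1)]
        linear_scale[OF lin(1)] orthogonal_transformation_norm scaleR_add_right)
qed

subsection \<open>Subdivisions as cuts\<close>

text \<open>\<open>subdivision a b n\<close> consists of the tiles whose relative size is at most a threshold that
  their parent exceeds.\<close>

definition cut :: "real \<Rightarrow> daughter list set" where
  "cut s = {w. size_of w \<le> s \<and> (w = [] \<or> s < size_of (butlast w))}"

definition subdivide_words :: "daughter list set \<Rightarrow> daughter list set" where
  "subdivide_words W =
    (\<Union>w\<in>W. if \<forall>v\<in>W. size_of v \<le> size_of w then range (\<lambda>d. w @ [d]) else {w})"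

lemma subdivide_largest_tile: "subdivide_largest (tile ` W) = tile ` subdivide_words W"
proof -
  have size: "tile_size (tile w) = c * size_of w" for w
    using tile_size_tile[of 1 id 0 w]
    by (simp add: orthogonal_transformation_def linear_id id_def[symmetric])
  have "subdivide_largest (tile ` W) =
      (\<Union>w\<in>W. if \<forall>v\<in>W. size_of v \<le> size_of w then daughters (tile w) else {tile w})"
    unfolding subdivide_largest_def image_image ball_simps size
    using pos by (intro SUP_cong) simp_all
  also have "\<dots> = (\<Union>w\<in>W. tile ` (if \<forall>v\<in>W. size_of v \<le> size_of w then range (\<lambda>d. w @ [d]) else {w}))"
    by (rule SUP_cong) (simp_all add: daughters_tile image_image)
  finally show ?thesis unfolding subdivide_words_def image_UN .
qed

lemma size_of_butlast: "w \<noteq> [] \<Longrightarrow> size_of w = size_of (butlast w) * ratio (last w)"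
  using size_of_append[of "butlast w" "[last w]"] by simp

lemma size_of_less_butlast: "w \<noteq> [] \<Longrightarrow> size_of w < size_of (butlast w)"
  using size_of_butlast[of w] ratio_less_1[of "last w"] size_of_pos[of "butlast w"] by simp

lemma in_cut_size_of: "w \<in> cut (size_of w)"
  using size_of_less_butlast[of w] by (auto simp: cut_def)

text \<open>The premise \<open>pred\<close> makes \<open>s\<close> the predecessor of
  \<open>h\<close> among the sizes. The words of size \<open>h\<close> are replaced by their
  children, whose sizes are below \<open>h\<close> and so at most \<open>s\<close>; this lowers the
  threshold from \<open>h\<close> to \<open>s\<close>.\<close>

lemma subdivide_words_cut:
  assumes h: "h \<in> range size_of" and pred: "\<And>x. x \<in> range size_of \<Longrightarrow> x < h \<longleftrightarrow> x \<le> s"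
  shows "subdivide_words (cut h) = cut s"
proof -
  obtain v where v: "h = size_of v" using h by blast
  have lt: "size_of w < h \<longleftrightarrow> size_of w \<le> s" for w using pred by blast
  have "s < h" using lt[of v] v by auto
  have max: "(\<forall>v\<in>cut h. size_of v \<le> size_of w) \<longleftrightarrow> size_of w = h" if "w \<in> cut h" for w
    using that in_cut_size_of[of v] v by (fastforce simp: cut_def)
  have "x \<in> subdivide_words (cut h) \<longleftrightarrow> x \<in> cut s" for x
  proof
    assume "x \<in> subdivide_words (cut h)"
    then obtain w where w: "w \<in> cut h" "size_of w = h \<and> x \<in> range (\<lambda>d. w @ [d]) \<or> size_of w \<noteq> h \<and> x = w"
      unfolding subdivide_words_def using max by (auto split: if_splits)
    show "x \<in> cut s"
    proof (cases "size_of w = h")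
      case True
      then obtain d where x: "x = w @ [d]" using w by blast
      then have "size_of x < h" using size_of_less_butlast[of x] True by simp
      then show ?thesis using lt[of x] True \<open>s < h\<close> x by (simp add: cut_def)
    next
      case False
      then show ?thesis using w lt[of w] lt[of "butlast w"] \<open>s < h\<close> by (auto simp: cut_def)
    qed
  next
    assume x: "x \<in> cut s"
    then have xh: "size_of x < h" using lt[of x] by (simp add: cut_def)
    then have "x \<noteq> []" using size_of_le_1[of v] v by auto
    then have bl: "h \<le> size_of (butlast x)" "x = butlast x @ [last x]"
      using x lt[of "butlast x"] by (auto simp: cut_def)
    show "x \<in> subdivide_words (cut h)"
    proof (cases "size_of (butlast x) = h")
      case True
      then have "butlast x \<in> cut h" using in_cut_size_of by metis
      moreover have "x \<in> range (\<lambda>d. butlast x @ [d])" using bl(2) by blast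
      ultimately show ?thesis unfolding subdivide_words_def using max True by fastforce
    next
      case False
      then have "x \<in> cut h" using bl xh by (simp add: cut_def)
      then show ?thesis unfolding subdivide_words_def using max[of x] xh by force
    qed
  qed
  then show ?thesis by blast
qed

text \<open>Each letter shrinks at least by the factor \<open>max \<rho> \<sigma> < 1\<close>, which
  bounds the length. Hence sizes accumulate only at 0 and each has a next smaller one.\<close>

lemma finite_size_of_ge:
  assumes "s > 0"
  shows "finite {w. s \<le> size_of w}"
proof -
  define m where "m = max \<rho> \<sigma>"
  have m: "0 < m" "m < 1" using \<rho>_pos \<rho>_less_1 \<sigma>_less_1 by (auto simp: m_def)
  have ratio_m: "ratio d \<le> m" for d by (cases d) (auto simp: m_def)
  have le: "size_of w \<le> m ^ length w" for w
  proof (induction w)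
    case (Cons d w)
    then show ?case
      using mult_mono[OF ratio_m[of d] Cons] m size_of_pos[of w] by simp
  qed simp
  obtain n where n: "m ^ n < s" using real_arch_pow_inv[OF assms m(2)] by blast
  have "length w \<le> n" if "s \<le> size_of w" for w
  proof (rule ccontr)
    assume "\<not> length w \<le> n"
    then have "m ^ length w \<le> m ^ n" using m by (intro power_decreasing) auto
    then show False using le[of w] n that by linarith
  qed
  then have "{w. s \<le> size_of w} \<subseteq> {w. set w \<subseteq> UNIV \<and> length w \<le> n}" by auto
  then show ?thesis using finite_lists_length_le[OF finite_daughter, of n] finite_subset by blast
qed

text \<open>Counts subdivision steps: by \<open>subdivision_rank\<close>, a size \<open>s\<close> is
  the largest relative size after \<open>rank s\<close> steps.\<close>

definition rank :: "real \<Rightarrow> nat" where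
  "rank s = card {x \<in> range size_of. s < x}"

lemma finite_sizes_ge: "s > 0 \<Longrightarrow> finite {x \<in> range size_of. s \<le> x}"
  by (rule finite_subset[OF _ finite_imageI[OF finite_size_of_ge[of s], of size_of]]) auto

lemma finite_sizes_gt: "s > 0 \<Longrightarrow> finite {x \<in> range size_of. s < x}"
  by (rule finite_subset[OF _ finite_sizes_ge[of s]]) auto

lemma rank_predecessor:
  assumes h: "h \<in> range size_of" and s: "s \<in> range size_of"
    and pred: "\<And>x. x \<in> range size_of \<Longrightarrow> x < h \<longleftrightarrow> x \<le> s"
  shows "rank s = Suc (rank h)"
proof -
  have "h > 0" using h size_of_pos by auto
  have "{x \<in> range size_of. s < x} = insert h {x \<in> range size_of. h < x}"
  proof (intro equalityI subsetI)
    fix x assume x: "x \<in> {x \<in> range size_of. s < x}"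
    then have "\<not> x < h" using pred[of x] by auto
    then show "x \<in> insert h {x \<in> range size_of. h < x}" using x by auto
  next
    fix x assume x: "x \<in> insert h {x \<in> range size_of. h < x}"
    then have "x \<in> range size_of" "\<not> x < h" using h by auto
    then show "x \<in> {x \<in> range size_of. s < x}" using pred[of x] by auto
  qed
  then show ?thesis
    unfolding rank_def using finite_sizes_gt[OF \<open>h > 0\<close>] by simp
qed

lemma rank_1: "rank 1 = 0"
proof -
  have "{x \<in> range size_of. 1 < x} = {}" using not_less_size_of by auto
  then show ?thesis by (simp only: rank_def card.empty)
qed

text \<open>Together with \<open>subdivision_rank\<close> this shows that every subdivision is a
  cut.\<close>

lemma rank_exists: "\<exists>s \<in> range size_of. rank s = n"
proof (induction n)
  case 0
  show ?case using rank_1 size_of_simps(1) by (metis rangeI)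
next
  case (Suc n)
  then obtain v where v: "rank (size_of v) = n" by blast
  \<comment> \<open>The size of a child bounds the set away from 0, so that it is finite, and
    belongs to it; the maximum is the next size below \<open>size_of v\<close>.\<close>
  let ?S = "{x \<in> range size_of. size_of (v @ [CFB]) \<le> x} \<inter> {x. x < size_of v}"
  have fin: "finite ?S" using finite_sizes_ge[OF size_of_pos, of "v @ [CFB]"] by blast
  have mem: "size_of (v @ [CFB]) \<in> ?S" using size_of_less_butlast[of "v @ [CFB]"]
    by (auto simp del: size_of_append)
  have max: "Max ?S \<in> ?S" using Max_in[OF fin] mem by blast
  have "x < size_of v \<longleftrightarrow> x \<le> Max ?S" if "x \<in> range size_of" for x
  proof
    assume x: "x < size_of v"
    show "x \<le> Max ?S"
    proof (cases "size_of (v @ [CFB]) \<le> x")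
      case True
      then show ?thesis using Max_ge[OF fin, of x] x that by blast
    next
      case False
      then show ?thesis using Max_ge[OF fin mem] by linarith
    qed
  next
    assume "x \<le> Max ?S"
    then show "x < size_of v" using max by auto
  qed
  then have "rank (Max ?S) = Suc n" using rank_predecessor[of "size_of v" "Max ?S"] max v by blast
  then show ?case using max by blast
qed

lemma cut_1: "cut 1 = {[]}"
  using not_less_size_of size_of_le_1 by (auto simp: cut_def)

text \<open>Induction on the rank: the least size above \<open>s\<close> has rank one less, and one
  subdivision step turns its cut into \<open>cut s\<close>.\<close>

lemma subdivision_rank:
  assumes "s \<in> range size_of"
  shows "subdivision a b (rank s) = tile ` cut s"
  using assms
proof (induction "rank s" arbitrary: s)
  case 0
  then have "s > 0" using size_of_pos by auto
  have "1 \<in> range size_of" using size_of_simps(1) by (metis rangeI)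
  then have "\<not> s < 1" using 0(1) finite_sizes_gt[OF \<open>s > 0\<close>] by (auto simp: rank_def)
  then have "s = 1" using 0(2) not_less_size_of by (metis rangeE linorder_neqE)
  then show ?case using rank_1 by (simp add: cut_1 subdivision_def)
next
  case (Suc n)
  then have "s > 0" using size_of_pos by auto
  let ?S = "{x \<in> range size_of. s < x}"
  have fin: "finite ?S" using finite_sizes_gt[OF \<open>s > 0\<close>] .
  have "?S \<noteq> {}" using Suc(2) unfolding rank_def by (metis card.empty nat.distinct(1))
  then have min: "Min ?S \<in> ?S" using Min_in[OF fin] by blast
  have pred: "x < Min ?S \<longleftrightarrow> x \<le> s" if "x \<in> range size_of" for x
  proof
    assume "x < Min ?S"
    then have "x \<notin> ?S" using Min_le[OF fin, of x] by linarith
    then show "x \<le> s" using that by auto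
  next
    assume "x \<le> s"
    then show "x < Min ?S" using min by auto
  qed
  have "rank s = Suc (rank (Min ?S))" using rank_predecessor[of "Min ?S" s] min pred Suc.prems by blast
  moreover have "subdivide_words (cut (Min ?S)) = cut s"
    using subdivide_words_cut[of "Min ?S" s] min pred by blast
  moreover have "subdivision a b n = tile ` cut (Min ?S)"
    using Suc(1)[of "Min ?S"] Suc(2) calculation(1) min by simp
  ultimately show ?case
    using Suc(2) subdivide_largest_tile[of "cut (Min ?S)"] by (simp add: subdivision_def)
qed

text \<open>Each step \<open>CFB\<close> shrinks the size by \<open>\<sigma>\<close>; when it first
  drops to at most \<open>s\<close>, the parent still exceeds \<open>s\<close>.\<close>

lemma ex_extension_in_cut:
  assumes "0 < s" "s < size_of u"
  shows "\<exists>i>0. u @ replicate i CFB \<in> cut s"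
proof -
  have size: "size_of (replicate i CFB) = \<sigma> ^ i" for i by (induction i) auto
  let ?P = "\<lambda>i. size_of (u @ replicate i CFB) \<le> s"
  obtain i where "\<sigma> ^ i < s / size_of u"
    using real_arch_pow_inv[OF _ \<sigma>_less_1, of "s / size_of u"] assms size_of_pos[of u] by auto
  then have "?P i" using size_of_pos[of u] by (simp add: size field_simps)
  then have P: "?P (Least ?P)" by (rule LeastI)
  then obtain k where k: "Least ?P = Suc k" using assms by (cases "Least ?P") auto
  then have "\<not> ?P k" using not_less_Least[of k ?P] by simp
  moreover have "butlast (u @ replicate (Suc k) CFB) = u @ replicate k CFB"
    by (simp add: butlast_append replicate_append_same[symmetric] del: replicate_Suc)
      (simp add: replicate_append_same[symmetric])
  ultimately have "u @ replicate (Suc k) CFB \<in> cut s"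
    using P k by (simp add: cut_def not_le del: replicate_Suc)
  then show ?thesis by blast
qed

end

subsection \<open>Dissection of the basic tile\<close>

lemma tile_region_subset_iff:
  assumes "convex S"
  shows "tile_region (P, Q, R) \<subseteq> S \<longleftrightarrow> P \<in> S \<and> Q \<in> S \<and> R \<in> S"
  by (simp add: subset_hull[of convex, OF assms])

lemma disjoint_interiors_if_separated:
  fixes n :: complex
  assumes "n \<noteq> 0" "S \<subseteq> {x. n \<bullet> x \<le> k}" "S' \<subseteq> {x. n \<bullet> x \<ge> k}"
  shows "interior S \<inter> interior S' = {}"
proof -
  have "interior S \<subseteq> {x. n \<bullet> x < k}" "interior S' \<subseteq> {x. n \<bullet> x > k}"
    using interior_mono[OF assms(2)] interior_mono[OF assms(3)] assms(1) by simp_all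
  then show ?thesis by fastforce
qed

context right_triangle
begin

lemma linear_eq_on_legs:
  fixes f g :: "complex \<Rightarrow> 'a::real_vector"
  assumes "linear f" "linear g" "f (Complex b 0) = g (Complex b 0)" "f (Complex b a) = g (Complex b a)"
  shows "f = g"
proof
  fix x
  have x: "x = (Re x / b - Im x / a) *\<^sub>R Complex b 0 + (Im x / a) *\<^sub>R Complex b a"
    using pos by (simp add: complex_eq_iff field_simps)
  show "f x = g x"
    by (subst (1 2) x) (simp add: assms linear_add[OF assms(1)] linear_add[OF assms(2)]
        linear_scale[OF assms(1)] linear_scale[OF assms(2)])
qed

text \<open>Weak separation by a line is recorded instead of disjoint interiors: it passes to
  descendants and also excludes inclusions.\<close>

definition separated :: "daughter \<Rightarrow> daughter \<Rightarrow> bool" where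
  "separated d d' \<longleftrightarrow> (\<exists>n k. n \<noteq> 0 \<and> tile_region (tile [d]) \<subseteq> {x. n \<bullet> x \<le> k}
    \<and> tile_region (tile [d']) \<subseteq> {x. n \<bullet> x \<ge> k})"

lemma separated_sym:
  assumes "separated d d'"
  shows "separated d' d"
proof -
  obtain n k where "n \<noteq> 0" "tile_region (tile [d]) \<subseteq> {x. n \<bullet> x \<le> k}"
    "tile_region (tile [d']) \<subseteq> {x. n \<bullet> x \<ge> k}"
    using assms unfolding separated_def by blast
  then show ?thesis
    unfolding separated_def by (intro exI[of _ "- n"] exI[of _ "- k"]) auto
qed

lemma foot_of_T_eq: "foot_of_T = (b / c)\<^sup>2 *\<^sub>R Complex b a"
  by (simp add: foot_of_T_def complex_eq_iff power_divide power2_eq_square power3_eq_cube)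

text \<open>The lines \<open>CF\<close>, \<open>MF\<close>, \<open>MN\<close> and \<open>MK\<close> separate the daughters.\<close>

lemma separated:
  assumes "d \<noteq> d'"
  shows "separated d d'"
proof -
  define r where "r = (b / c)\<^sup>2"
  have F: "foot_of_T = r *\<^sub>R Complex b a" using foot_of_T_eq by (simp add: r_def)
  have rc: "r * c\<^sup>2 = b\<^sup>2" using pos by (simp add: r_def power_divide)
  have r: "r * (b * b + a * a) = b * b"
    using rc pyth by (simp add: power2_eq_square add.commute)
  have r': "r * (2 * a * b * b + (a * a - b * b) * a) = a * b * b"
  proof -
    have "r * (2 * a * b * b + (a * a - b * b) * a) = a * (r * (b * b + a * a))"
      by (simp add: algebra_simps)
    then show ?thesis unfolding r by simp
  qed
  have foot: "n \<bullet> foot_of_T = r * (Re n * b + Im n * a)" for n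
    by (simp add: F inner_complex_def field_simps)
  have mid: "n \<bullet> midpoint x y = (n \<bullet> x + n \<bullet> y) / 2" for n x y :: complex
    by (simp add: midpoint_def inner_add_right)
  have sepI: "separated d d'"
    if "n \<noteq> 0" "tile [d] = (P, Q, R)" "tile [d'] = (P', Q', R')"
      "n \<bullet> P \<le> k" "n \<bullet> Q \<le> k" "n \<bullet> R \<le> k" "n \<bullet> P' \<ge> k" "n \<bullet> Q' \<ge> k" "n \<bullet> R' \<ge> k"
    for d d' n k P Q R P' Q' R'
    unfolding separated_def that(2,3)
    using that(1,4-) tile_region_subset_iff[OF convex_halfspace_le, of P Q R n k]
      tile_region_subset_iff[OF convex_halfspace_ge, of P' Q' R' k n] by blast
  have pos': "b * b > 0" "a * b > 0" "a * b * b > 0" using pos by auto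
  have foot_vals: "Complex b a \<bullet> foot_of_T = b * b"
    "Complex (2 * a * b) (a * a - b * b) \<bullet> foot_of_T = a * b * b"
    "Complex a (- b) \<bullet> foot_of_T = 0"
    unfolding foot using r r' by simp_all
  have cf_vals: "Complex b a \<bullet> foot_of_T = b * b" "Complex b a \<bullet> Complex b 0 = b * b"
    "Complex b a \<bullet> Complex b a \<ge> b * b" "Complex b a \<noteq> 0"
    using foot_vals pos by (auto simp: inner_complex_def complex_eq_iff)
  \<comment> \<open>The line \<open>CF\<close> is perpendicular to \<open>AB\<close>, so it is the
    level \<open>b * b\<close> of the normal \<open>Complex b a\<close>; \<open>MN\<close> is
    parallel to it at half that level.\<close>
  have cf: "separated d CFB" if "d \<noteq> CFB" for d
    using cf_vals pos' that
    by (cases d) (auto intro!: sepI[OF cf_vals(4) _ tile_singleton(5), where k = "b * b"] tile_singleton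
        simp: mid simp del: tile_region.simps)
  have mn: "separated ANM FNM"
    using cf_vals pos' by (intro sepI[OF cf_vals(4) tile_singleton(1,4), where k = "b * b / 2"])
      (simp_all add: mid)
  \<comment> \<open>A normal of the line \<open>MF\<close>, whose direction is
    \<open>(b\<^sup>2 - a\<^sup>2, 2 * a * b)\<close> up to a factor.\<close>
  define n where "n = Complex (2 * a * b) (a * a - b * b)"
  have mf_vals: "n \<bullet> foot_of_T = a * b * b" "n \<bullet> Complex b 0 = 2 * (a * b * b)" "n \<noteq> 0"
    using foot_vals(2) pos by (auto simp: n_def inner_complex_def complex_eq_iff)
  have mf: "separated ANM MKC" "separated ANM MKF" "separated FNM MKC" "separated FNM MKF"
    using mf_vals pos'
    by - (rule sepI[OF mf_vals(3) tile_singleton(1,2), where k = "a * b * b"]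
        sepI[OF mf_vals(3) tile_singleton(1,3), where k = "a * b * b"]
        sepI[OF mf_vals(3) tile_singleton(4,2), where k = "a * b * b"]
        sepI[OF mf_vals(3) tile_singleton(4,3), where k = "a * b * b"]; simp add: mid)+
  have mk_vals: "Complex a (- b) \<bullet> foot_of_T = 0" "Complex a (- b) \<bullet> Complex b 0 = a * b"
    "Complex a (- b) \<noteq> 0"
    using foot_vals(3) pos by (auto simp: inner_complex_def complex_eq_iff)
  \<comment> \<open>The line \<open>MK\<close> is parallel to \<open>AB\<close>, which has the
    normal \<open>Complex a (- b)\<close>.\<close>
  have mk: "separated MKF MKC"
    using mk_vals pos' by (intro sepI[OF mk_vals(3) tile_singleton(3,2), where k = "a * b / 2"])
      (simp_all add: mid)
  show ?thesis
    using assms cf mf mn mk separated_sym by (cases d; cases d') auto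
qed

section \<open>Containment and disjointness of the tiles of a cut\<close>

lemma tile_region_daughter: "tile_region (tile [d]) \<subseteq> tile_region T"
proof -
  let ?S = "tile_region T"
  have conv: "convex ?S" by (simp add: basic_tile_def)
  have vertices: "0 \<in> ?S" "Complex b 0 \<in> ?S" "Complex b a \<in> ?S"
    by (simp_all add: basic_tile_def hull_inc)
  have mid: "midpoint x y \<in> ?S" if "x \<in> ?S" "y \<in> ?S" for x y
    using conv that midpoint_in_closed_segment closed_segment_subset by blast
  have "b\<^sup>2 \<le> c\<^sup>2" unfolding pyth[symmetric] by simp
  then have "b \<le> c" by (rule power2_le_imp_le) (use pos in simp)
  then have "(b / c)\<^sup>2 \<le> 1" using pos by (simp add: power_le_one)
  \<comment> \<open>As \<open>b \<le> c\<close>, the foot is a convex combination of the vertices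
    \<open>A\<close> and \<open>B\<close>.\<close>
  then have "(1 - (b / c)\<^sup>2) *\<^sub>R 0 + (b / c)\<^sup>2 *\<^sub>R Complex b a \<in> ?S"
    using convexD_alt[OF conv vertices(1,3), of "(b / c)\<^sup>2"] by simp
  then have "foot_of_T \<in> ?S" by (simp add: foot_of_T_eq)
  then show ?thesis
    using vertices mid by (cases d) (simp_all only: tile_singleton tile_region_subset_iff[OF conv])
qed

lemma tile_region_append: "tile_region (tile (v @ w)) = place_word v ` tile_region (tile w)"
  by (simp add: tile_append tile_region_map_tile similarity_place_word)

lemma tile_region_word: "tile_region (tile w) \<subseteq> tile_region T"
proof (induction w)
  case (Cons d w)
  have "tile_region (tile (d # w)) \<subseteq> place_word [d] ` tile_region T"
    using tile_region_append[of "[d]" w] Cons by auto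
  also have "\<dots> = tile_region (tile [d])"
    using tile_region_append[of "[d]" "[]"] by simp
  finally show ?case using tile_region_daughter by blast
qed simp

lemma tile_region_Cons: "tile_region (tile (d # w)) \<subseteq> tile_region (tile [d])"
  using tile_region_append[of "[d]" w] tile_region_append[of "[d]" "[]"] tile_region_word[of w]
  by auto

text \<open>A tile inside two separated daughters would lie on the separating line; the normal would
  then be orthogonal to the image of a basis and vanish.\<close>

lemma tile_region_not_subset:
  assumes "d \<noteq> d'"
  shows "\<not> tile_region (tile (d # w)) \<subseteq> tile_region (tile [d'])"
proof
  assume sub: "tile_region (tile (d # w)) \<subseteq> tile_region (tile [d'])"
  obtain n k where n: "n \<noteq> 0" "tile_region (tile [d]) \<subseteq> {x. n \<bullet> x \<le> k}"
    "tile_region (tile [d']) \<subseteq> {x. n \<bullet> x \<ge> k}"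
    using separated[OF assms] unfolding separated_def by blast
  then have k: "n \<bullet> x = k" if "x \<in> tile_region (tile (d # w))" for x
    using tile_region_Cons[of d w] sub that by force
  obtain u where u: "place_word (d # w) = (\<lambda>x. u + size_of (d # w) *\<^sub>R rot (d # w) x)"
    using place_word_eq by blast
  let ?g = "rot (d # w)"
  have g: "orthogonal_transformation ?g" by (rule orthogonal_rot)
  then have lin: "linear ?g" by (simp add: orthogonal_transformation_def)
  have "place_word (d # w) x \<in> tile_region (tile (d # w))" if "x \<in> {0, Complex b 0, Complex b a}" for x
    using that tile_region_append[of "d # w" "[]"] by (auto simp: basic_tile_def hull_inc)
  then have eq: "n \<bullet> (u + size_of (d # w) *\<^sub>R ?g x) = k" if "x \<in> {0, Complex b 0, Complex b a}" for x
    using that k unfolding u by blast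
  have "n \<bullet> u = k" using eq[of 0] by (simp add: linear_0[OF lin] del: rot.simps)
  then have zero: "n \<bullet> ?g x = 0" if "x \<in> {0, Complex b 0, Complex b a}" for x
    using eq[OF that] size_of_pos[of "d # w"]
    by (simp add: inner_add_right del: rot.simps size_of_simps)
  have "linear (\<lambda>x. n \<bullet> ?g x)"
    using lin by (auto intro!: linearI simp: linear_add linear_scale inner_add_right simp del: rot.simps)
  then have "(\<lambda>x. n \<bullet> ?g x) = (\<lambda>x. 0)"
    by (rule linear_eq_on_legs) (use zero in \<open>auto intro!: linearI simp del: rot.simps\<close>)
  moreover obtain x where "?g x = n"
    using orthogonal_transformation_surj[OF g] by (metis surjD)
  ultimately have "n \<bullet> n = 0" by metis
  then show False using n(1) by simp
qed

text \<open>A proper prefix of a word is at least as large as its parent, so no word of a cut is a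
  proper prefix of another. Two words thus branch at some letter, and there they enter separated
  daughters.\<close>

lemma disjoint_interiors_cut:
  assumes "v \<in> cut s" "w \<in> cut s" "v \<noteq> w"
  shows "interior (tile_region (tile v)) \<inter> interior (tile_region (tile w)) = {}"
proof -
  have no_prefix: "\<not> strict_prefix x y" if "x \<in> cut s" "y \<in> cut s" for x y
  proof
    assume "strict_prefix x y"
    then obtain d z where y: "y = x @ d # z" by (auto elim: strict_prefixE')
    then have "size_of (butlast y) \<le> size_of x"
      using size_of_le_1[of "butlast (d # z)"] size_of_pos[of x] by (simp add: butlast_append)
    then show False using that y by (auto simp: cut_def)
  qed
  have "v \<parallel> w" using no_prefix[OF assms(1,2)] no_prefix[OF assms(2,1)] assms(3)
    by (auto intro!: parallelI simp: strict_prefix_def)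
  then obtain p d v' d' w' where vw: "d \<noteq> d'" "v = p @ d # v'" "w = p @ d' # w'"
    using parallel_decomp by blast
  obtain n k where n: "n \<noteq> 0" "tile_region (tile [d]) \<subseteq> {x. n \<bullet> x \<le> k}"
    "tile_region (tile [d']) \<subseteq> {x. n \<bullet> x \<ge> k}"
    using separated[OF vw(1)] unfolding separated_def by blast
  have "interior (tile_region (tile (d # v'))) \<inter> interior (tile_region (tile (d' # w'))) = {}"
    using n tile_region_Cons by (intro disjoint_interiors_if_separated[of n _ k]) blast+
  then show ?thesis
    unfolding vw tile_region_append interior_similarity[OF similarity_place_word]
    by (simp add: image_Int[OF similarity_inj[OF similarity_place_word], symmetric])
qed

end

subsection \<open>Finiteness of sizes and orientations\<close>

lemma hierarchical_tilingE:
  assumes "hierarchical_tiling a b X"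
  obtains S :: "nat \<Rightarrow> tile set" and N :: "nat \<Rightarrow> nat" where "X = (\<Union>i. S i)" "strict_mono N" "mono S"
    "\<And>i. \<exists>f. similarity f \<and> S i = map_tile f ` subdivision a b (N i)"
proof -
  obtain S :: "nat \<Rightarrow> tile set" and N where SN: "X = (\<Union>i. S i)" "strict_mono N"
    "\<And>i. supertile a b (N i) (S i)" "\<And>i. S i \<subset> S (Suc i)"
    using assms unfolding hierarchical_tiling_def by blast
  have "mono S" using SN(4) by (intro mono_iff_le_Suc[THEN iffD2]) blast
  moreover have "\<exists>f. similarity f \<and> S i = map_tile f ` subdivision a b (N i)" for i
    using SN(3)[of i] unfolding supertile_def similarity_iff_motion_rescaling by metis
  ultimately show ?thesis using that SN(1,2) by blast
qed

context right_triangle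
begin

lemma has_orientation_tile:
  assumes "k > 0" "orthogonal_transformation g"
  shows "has_orientation a b (map_tile (\<lambda>x. u + k *\<^sub>R g x) (tile w)) (g \<circ> rot w)"
proof -
  obtain v where v: "place_word w = (\<lambda>x. v + size_of w *\<^sub>R rot w x)"
    using place_word_eq by blast
  have lin: "linear g" using assms by (simp add: orthogonal_transformation_def)
  have "(\<lambda>x. u + k *\<^sub>R g x) \<circ> place_word w =
      (\<lambda>x. (u + k *\<^sub>R g v) + (k * size_of w) *\<^sub>R (g \<circ> rot w) x)"
    by (simp add: v fun_eq_iff linear_add[OF lin] linear_scale[OF lin] scaleR_add_right)
  moreover have "k * size_of w > 0" using assms size_of_pos[of w] by simp
  ultimately show ?thesis
    unfolding has_orientation_def tile_def map_tile_comp
    using orthogonal_transformation_compose[OF assms(2) orthogonal_rot[of w]] by metis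
qed

text \<open>The length of the image of the long leg determines the scale; the images of a basis then
  determine the linear part.\<close>

lemma orientation_unique:
  assumes "has_orientation a b t g" "has_orientation a b t h"
  shows "g = h"
proof -
  obtain u k v l where g: "orthogonal_transformation g" "k > 0" "t = map_tile (\<lambda>x. u + k *\<^sub>R g x) T"
    and h: "orthogonal_transformation h" "l > 0" "t = map_tile (\<lambda>x. v + l *\<^sub>R h x) T"
    using assms unfolding has_orientation_def by metis
  have lin: "linear g" "linear h" using g h by (auto simp: orthogonal_transformation_def)
  have eq: "k *\<^sub>R g (Complex b 0) = l *\<^sub>R h (Complex b 0)"
    "k *\<^sub>R g (Complex b a) = l *\<^sub>R h (Complex b a)"
    using g(3) h(3) by (auto simp: basic_tile_def linear_0[OF lin(1)] linear_0[OF lin(2)])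
  have "k * norm (Complex b 0) = l * norm (Complex b 0)"
    using arg_cong[OF eq(1), of norm] g h by (simp add: orthogonal_transformation_norm)
  then have "k = l" using pos by (simp add: cmod_def)
  then show ?thesis using eq g(2) by (intro linear_eq_on_legs lin) auto
qed

lemma size_of_replicate [simp]: "size_of (replicate n d) = ratio d ^ n"
  by (induction n) auto

lemma rot_replicate_MKF: "rot (replicate j MKF) x = dir ^ j * x"
  by (induction j) (auto simp: mult.assoc)

text \<open>The map \<open>turn CFB\<close> is a reflection, so only the parity of \<open>i\<close>
  matters.\<close>

lemma rot_replicate_CFB: "rot (replicate i CFB) x = (if even i then x else \<i> * dir * cnj x)"
proof (induction i)
  case (Suc i)
  have "dir * cnj dir = 1" using norm_dir complex_norm_square[of dir] by simp
  then have "dir * (cnj dir * x) = x" by (simp add: mult.assoc[symmetric])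
  then show ?case using Suc by (auto simp: algebra_simps)
qed simp

text \<open>The tiles reached by \<open>j\<close> steps \<open>MKF\<close> followed by steps \<open>CFB\<close> have relative size
  \<open>\<rho> ^ j * \<sigma> ^ i\<close> and are rotated by \<open>j * \<theta>\<close>, up to a reflection.\<close>

lemma isosceles_if_finite:
  assumes X: "hierarchical_tiling a b X"
    and orient: "finitely_many_orientations a b X" and sizes: "finitely_many_sizes X"
  shows "a = b"
proof -
  obtain S :: "nat \<Rightarrow> tile set" and N :: "nat \<Rightarrow> nat" where S: "X = (\<Union>i. S i)" "strict_mono N" "mono S"
    "\<And>i. \<exists>f. similarity f \<and> S i = map_tile f ` subdivision a b (N i)"
    using hierarchical_tilingE[OF X] by metis
  define Or where "Or = {g. \<exists>t\<in>X. has_orientation a b t g}"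
  have fin: "finite Or" "finite (tile_size ` X)"
    using orient sizes by (simp_all add: finitely_many_orientations_def finitely_many_sizes_def Or_def)
  \<comment> \<open>The \<open>J + 1\<close> words for \<open>j = 0..J\<close> outnumber both the
    sizes and the orientations, so each of the two must repeat.\<close>
  define J where "J = max (card Or) (card (tile_size ` X))"
  \<comment> \<open>\<open>N I \<ge> I\<close> exceeds the number of sizes at least
    \<open>\<rho> ^ J\<close>, so the threshold \<open>s\<close> of rank \<open>N I\<close> is below
    \<open>\<rho> ^ J\<close> and all these words extend into the cut.\<close>
  define I where "I = Suc (card {x \<in> range size_of. \<rho> ^ J \<le> x})"
  obtain s where s: "s \<in> range size_of" "rank s = N I" using rank_exists[of "N I"] by (elim bexE)
  have "s < \<rho> ^ J"
  proof (rule ccontr)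
    assume "\<not> s < \<rho> ^ J"
    then have "rank s \<le> card {x \<in> range size_of. \<rho> ^ J \<le> x}"
      unfolding rank_def using \<rho>_pos by (intro card_mono finite_sizes_ge) auto
    moreover have "I \<le> N I" using S(2) by (rule strict_mono_imp_increasing)
    ultimately show False using s(2) by (simp add: I_def)
  qed
  have "s > 0" using s(1) size_of_pos by auto
  have "\<exists>i. replicate j MKF @ replicate i CFB \<in> cut s" if "j \<le> J" for j
  proof -
    have "\<rho> ^ J \<le> \<rho> ^ j" using \<rho>_pos \<rho>_less_1 that by (intro power_decreasing) auto
    then show ?thesis
      using ex_extension_in_cut[OF \<open>s > 0\<close>, of "replicate j MKF"] \<open>s < \<rho> ^ J\<close> by auto
  qed
  then obtain i where i: "\<And>j. j \<le> J \<Longrightarrow> replicate j MKF @ replicate (i j) CFB \<in> cut s" by metis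
  define w where "w j = replicate j MKF @ replicate (i j) CFB" for j
  obtain u k g where f: "k > 0" "orthogonal_transformation g"
    "S I = map_tile (\<lambda>x. u + k *\<^sub>R g x) ` subdivision a b (N I)"
    using S(4)[of I] unfolding similarity_def by metis
  have in_X: "map_tile (\<lambda>x. u + k *\<^sub>R g x) (tile (w j)) \<in> X" if "j \<le> J" for j
    using i[OF that] subdivision_rank[OF s(1)] unfolding S(1) w_def using f(3) s(2) by auto
  have collide: "\<exists>x y. x < y \<and> h x = h y" if "h ` {..J} \<subseteq> F" "finite F" "card F \<le> J"
    for h :: "nat \<Rightarrow> 'c" and F
  proof -
    have "card (h ` {..J}) < card {..J}" using card_mono[OF that(2,1)] that(3) by simp
    from pigeonhole[OF this] show ?thesis unfolding inj_on_def by (metis linorder_neqE_nat)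
  qed
  have "(\<lambda>j. k * c * size_of (w j)) ` {..J} \<subseteq> tile_size ` X"
  proof (rule image_subsetI)
    fix j assume "j \<in> {..J}"
    then show "k * c * size_of (w j) \<in> tile_size ` X"
      unfolding tile_size_tile[OF f(1,2), of u, symmetric] by (intro imageI in_X) simp
  qed
  from collide[OF this fin(2)]
  obtain x y where xy: "x < y" "k * c * size_of (w x) = k * c * size_of (w y)"
    by (auto simp: J_def)
  then have "\<rho> ^ x * \<sigma> ^ i x = \<rho> ^ y * \<sigma> ^ i y" using f(1) pos by (simp add: w_def)
  also have "\<rho> ^ y = \<rho> ^ x * \<rho> ^ (y - x)" using xy(1) by (simp add: power_add[symmetric])
  finally have eq: "\<sigma> ^ i x = \<rho> ^ (y - x) * \<sigma> ^ i y" using \<rho>_pos by simp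
  \<comment> \<open>The factor \<open>\<rho> ^ (y - x)\<close> is below 1, so \<open>eq\<close>
    needs the larger exponent of \<open>\<sigma>\<close> on its left; this makes the exponent in
    \<open>rel\<close> positive.\<close>
  have lt: "i y < i x"
  proof (rule ccontr)
    assume "\<not> i y < i x"
    then have "\<sigma> ^ i y \<le> \<sigma> ^ i x" using \<sigma>_pos \<sigma>_less_1 by (intro power_decreasing) auto
    moreover have "\<rho> ^ (y - x) * \<sigma> ^ i y < 1 * \<sigma> ^ i y"
      using xy(1) \<rho>_pos \<rho>_less_1 \<sigma>_pos by (intro mult_strict_right_mono) (auto simp: power_less_one_iff)
    ultimately show False using eq by simp
  qed
  then have "\<sigma> ^ i x = \<sigma> ^ (i x - i y) * \<sigma> ^ i y" by (simp add: power_add[symmetric])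
  then have rel: "\<sigma> ^ (i x - i y) = \<rho> ^ (y - x)" using eq \<sigma>_pos by simp
  have "(\<lambda>j. g \<circ> rot (w j)) ` {..J} \<subseteq> Or"
    using in_X has_orientation_tile[OF f(1,2), of u] unfolding Or_def by blast
  from collide[OF this fin(1)]
  obtain x' y' where xy': "x' < y'" "g \<circ> rot (w x') = g \<circ> rot (w y')"
    by (auto simp: J_def)
  have "rot (w x') z = rot (w y') z" for z
    using xy'(2) orthogonal_transformation_inj[OF f(2)] by (metis comp_apply injD)
  then have rot: "dir ^ x' * (if even (i x') then z else \<i> * dir * cnj z) =
      dir ^ y' * (if even (i y') then z else \<i> * dir * cnj z)" for z
    by (simp add: w_def rot_append rot_replicate_MKF rot_replicate_CFB)
  have dir0: "dir \<noteq> 0" using norm_dir by auto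
  \<comment> \<open>Unequal parities would identify a rotation with a reflection, which the
    arguments 1 and \<i> exclude; for equal parities the common factor cancels.\<close>
  have "dir ^ x' = dir ^ y'"
    using rot[of 1] rot[of \<i>] dir0 by (auto split: if_splits simp: algebra_simps)
  then have unity: "dir ^ (y' - x') = 1"
    using xy'(1) dir0 by (simp add: power_diff)
  have "\<sigma> = 2 * \<rho>"
  proof (rule isosceles_if_commensurable[OF \<rho>_pos \<sigma>_pos \<sigma>_\<rho> _ _ rel _ _ unity])
    show "dir = Complex (2 * \<rho>) \<sigma>"
      unfolding dir_def \<rho>_def \<sigma>_def by simp
  qed (use xy(1) xy'(1) lt in auto)
  then show ?thesis using pos by (simp add: \<rho>_def \<sigma>_def)
qed

text \<open>The numbers of sizes and of orientations are bounded uniformly over the increasing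
  supertiles, so they stay finite in the union.\<close>

lemma finite_if_isosceles:
  assumes X: "hierarchical_tiling a b X" and "a = b"
  shows "finitely_many_orientations a b X \<and> finitely_many_sizes X"
proof -
  obtain S :: "nat \<Rightarrow> tile set" and N :: "nat \<Rightarrow> nat" where S: "X = (\<Union>i. S i)" "mono S"
    "\<And>i. \<exists>f. similarity f \<and> S i = map_tile f ` subdivision a b (N i)"
    using hierarchical_tilingE[OF X] by metis
  have \<rho>: "\<rho> = \<sigma> / 2" unfolding \<rho>_def \<sigma>_def using \<open>a = b\<close> by simp
  have \<sigma>2: "\<sigma>\<^sup>2 = 1 / 2" using \<sigma>_\<rho> unfolding \<rho> by (simp add: power_divide)
  then have \<rho>3: "\<rho> = \<sigma> ^ 3" unfolding \<rho> by (simp add: power3_eq_cube power2_eq_square)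
  have pow: "\<exists>n. size_of w = \<sigma> ^ n" for w
  proof (induction w)
    case Nil
    show ?case by (intro exI[of _ 0]) simp
  next
    case (Cons d w)
    then obtain n where "size_of w = \<sigma> ^ n" by blast
    then show ?case
      using \<rho>3 by (cases d) (auto simp: power_add[symmetric] intro: exI[of _ "Suc n"] exI[of _ "3 + n"])
  qed
  \<comment> \<open>The dihedral group of order 16: for equal legs \<open>dir\<close> is an eighth
    root of unity, so every \<open>turn\<close> lies in it.\<close>
  define H where "H = (\<lambda>v x. v * x) ` {v::complex. v ^ 8 = 1} \<union> (\<lambda>v x. v * cnj x) ` {v. v ^ 8 = 1}"
  have dir2: "dir * dir = \<i>"
  proof -
    have "dir = Complex \<sigma> \<sigma>" unfolding dir_def \<sigma>_def using \<open>a = b\<close> by simp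
    then show ?thesis using \<sigma>2 by (simp add: complex_eq_iff power2_eq_square)
  qed
  have dir8: "dir ^ 8 = 1"
  proof -
    have "dir ^ 8 = (dir * dir) ^ 4" by (simp add: power2_eq_square[symmetric] power_mult[symmetric])
    then show ?thesis by (simp add: dir2)
  qed
  have H1: "(\<lambda>x. v * x) \<in> H" and H2: "(\<lambda>x. v * cnj x) \<in> H" if "v ^ 8 = 1" for v
    using that by (auto simp: H_def)
  have HE: "\<exists>v. v ^ 8 = 1 \<and> (p = (\<lambda>x. v * x) \<or> p = (\<lambda>x. v * cnj x))" if "p \<in> H" for p
    using that by (auto simp: H_def)
  have turn: "turn d \<in> H" for d
    using dir8 H1[of dir] H2[of dir] H1[of "- dir"] H2[of "\<i> * dir"]
    by (cases d) (simp_all add: power_mult_distrib)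
  have comp: "p \<circ> q \<in> H" if pq: "p \<in> H" "q \<in> H" for p q
  proof -
    obtain v w where vw: "v ^ 8 = 1" "p = (\<lambda>x. v * x) \<or> p = (\<lambda>x. v * cnj x)"
      "w ^ 8 = 1" "q = (\<lambda>x. w * x) \<or> q = (\<lambda>x. w * cnj x)"
      using HE[OF pq(1)] HE[OF pq(2)] by blast
    have "cnj w ^ 8 = 1" using vw(3) by (metis complex_cnj_one complex_cnj_power)
    then have "(v * w) ^ 8 = 1" "(v * cnj w) ^ 8 = 1"
      using vw by (simp_all add: power_mult_distrib)
    from this[THEN H1] this[THEN H2] show ?thesis
      using vw(2,4) by (auto simp: o_def mult.assoc)
  qed
  have rot: "rot w \<in> H" for w
  proof (induction w)
    case Nil
    show ?case using H1[of 1] by (simp add: id_def)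
  next
    case (Cons d w)
    then show ?case unfolding rot.simps by (intro comp turn)
  qed
  have "finite H" unfolding H_def using finite_roots_unity[of 8, where 'a = complex] by simp
  define Or where "Or i = {g. \<exists>t\<in>S i. has_orientation a b t g}" for i
  have Or: "finite (Or i) \<and> card (Or i) \<le> card H"
    and sizes: "finite (tile_size ` S i) \<and> card (tile_size ` S i) \<le> 3" for i
  proof -
    obtain u k g where f: "k > 0" "orthogonal_transformation g"
      "S i = map_tile (\<lambda>x. u + k *\<^sub>R g x) ` subdivision a b (N i)"
      using S(3)[of i] unfolding similarity_def by metis
    obtain v where v: "rank (size_of v) = N i" using rank_exists[of "N i"] by (elim bexE imageE) simp
    then have Si: "S i = (\<lambda>w. map_tile (\<lambda>x. u + k *\<^sub>R g x) (tile w)) ` cut (size_of v)"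
      using f(3) subdivision_rank[of "size_of v"] by (simp add: image_image)
    have "Or i \<subseteq> (\<lambda>h. g \<circ> h) ` H"
    proof
      fix h assume "h \<in> Or i"
      then obtain w where "has_orientation a b (map_tile (\<lambda>x. u + k *\<^sub>R g x) (tile w)) h"
        unfolding Or_def Si by blast
      then have "h = g \<circ> rot w" using has_orientation_tile[OF f(1,2)] orientation_unique by blast
      then show "h \<in> (\<lambda>h. g \<circ> h) ` H" using rot by blast
    qed
    then show "finite (Or i) \<and> card (Or i) \<le> card H"
      using \<open>finite H\<close> by (meson card_image_le card_mono finite_imageI finite_subset le_trans)
    obtain n where n: "size_of v = \<sigma> ^ n" using pow by blast
    \<comment> \<open>The size is at most \<open>\<sigma> ^ n\<close>, the size of the parent
      exceeds it, and a letter costs at most the factor \<open>\<sigma> ^ 3\<close>; this leaves the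
      exponents \<open>n\<close>, \<open>n + 1\<close>, \<open>n + 2\<close>.\<close>
    have "size_of w \<in> (\<lambda>m. \<sigma> ^ m) ` {n..<n + 3}" if w: "w \<in> cut (size_of v)" for w
    proof -
      obtain m where m: "size_of w = \<sigma> ^ m" using pow by blast
      have "n \<le> m"
        using w \<sigma>_pos \<sigma>_less_1 by (auto simp: cut_def n m)
      moreover have "m < n + 3"
      proof (cases "w = []")
        case True
        then show ?thesis using m \<sigma>_pos \<sigma>_less_1 power_eq_1_iff[of \<sigma> m] by (cases m) auto
      next
        case False
        then have "\<sigma> ^ n < size_of (butlast w)" using w n by (auto simp: cut_def)
        moreover have "\<sigma> ^ 3 \<le> ratio d" for d
          using \<rho>3 \<rho> \<sigma>_pos by (cases d) auto
        ultimately have "\<sigma> ^ n * \<sigma> ^ 3 < size_of (butlast w) * ratio (last w)"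
          using \<sigma>_pos by (intro mult_less_le_imp_less) auto
        then have "\<sigma> ^ (n + 3) < \<sigma> ^ m" using size_of_butlast[OF False] m by (simp add: power_add)
        then show ?thesis using \<sigma>_pos \<sigma>_less_1 by (simp add: power_strict_decreasing_iff)
      qed
      ultimately show ?thesis using m by auto
    qed
    then have sub: "tile_size ` S i \<subseteq> (\<lambda>m. k * c * \<sigma> ^ m) ` {n..<n + 3}"
      unfolding Si using tile_size_tile[OF f(1,2)] by fastforce
    have "card ((\<lambda>m. k * c * \<sigma> ^ m) ` {n..<n + 3}) \<le> 3"
      using card_image_le[of "{n..<n + 3}" "\<lambda>m. k * c * \<sigma> ^ m"] by simp
    then show "finite (tile_size ` S i) \<and> card (tile_size ` S i) \<le> 3"
      using sub by (meson card_mono finite_atLeastLessThan finite_imageI finite_subset le_trans)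
  qed
  have "mono Or" "mono (\<lambda>i. tile_size ` S i)"
    using monoD[OF S(2)] by (auto simp: Or_def intro!: monoI image_mono) blast
  then have "finite (\<Union>i. Or i)" "finite (\<Union>i. tile_size ` S i)"
    using finite_UN_if_card_bounded Or sizes by blast+
  moreover have "{g. \<exists>t\<in>X. has_orientation a b t g} = (\<Union>i. Or i)"
    by (auto simp: S(1) Or_def)
  ultimately show ?thesis
    by (simp add: finitely_many_orientations_def finitely_many_sizes_def S(1) image_UN)
qed

subsection \<open>Existence of hierarchical tilings\<close>

text \<open>Inverse of \<open>place ANM\<close>, a scaled reflection fixing the vertex 0. A
  reflection is its own inverse, so the formula of \<open>turn ANM\<close> reappears.\<close>

definition grow :: "complex \<Rightarrow> complex" where
  "grow x = (1 / \<rho>) *\<^sub>R (dir * cnj x)"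

lemma grow_place_ANM: "grow \<circ> place ANM = id"
proof -
  have "dir * (cnj dir * x) = x" for x
    using norm_dir complex_norm_square[of dir] by (simp add: mult.assoc[symmetric])
  then show ?thesis
    using \<rho>_pos by (simp add: grow_def place_def fun_eq_iff)
qed

lemma similarity_grow: "similarity grow"
  using similarityI[of "1 / \<rho>" "\<lambda>x. dir * cnj x" 0] \<rho>_pos orthogonal_transformation_mult(2)[OF norm_dir]
  by (simp add: grow_def[abs_def])

lemma norm_grow: "norm ((grow ^^ n) x) = norm x / \<rho> ^ n"
  using \<rho>_pos by (induction n) (simp_all add: grow_def norm_mult norm_dir)

lemma power_in_range: "\<rho> ^ n \<in> range size_of"
  using size_of_replicate[of n ANM] by (metis ratio.simps(2) rangeI)

lemma \<rho>_power_Suc: "\<rho> ^ Suc n < 1"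
  using power_less_one_iff[of \<rho> "Suc n"] \<rho>_pos \<rho>_less_1 by (simp del: power_Suc)

text \<open>A leading \<open>ANM\<close> multiplies every size by \<open>\<rho>\<close>. For the
  empty \<open>w\<close>, the parent of \<open>[ANM]\<close> is the root, whose size 1 exceeds the
  threshold.\<close>

lemma cut_Cons_ANM: "ANM # w \<in> cut (\<rho> ^ Suc n) \<longleftrightarrow> w \<in> cut (\<rho> ^ n)"
  using \<rho>_power_Suc[of n] \<rho>_pos by (auto simp: cut_def)

text \<open>Every word of this cut is nonempty, and its first letter decides whether the tile lies
  in the daughter \<open>ANM\<close>.\<close>

lemma cut_sub_ANM:
  "{t \<in> subdivision a b (rank (\<rho> ^ Suc n)). tile_region t \<subseteq> tile_region (tile [ANM])} =
    (\<lambda>w. tile (ANM # w)) ` cut (\<rho> ^ n)"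
proof -
  have Nil_notin: "[] \<notin> cut (\<rho> ^ Suc n)" using \<rho>_power_Suc[of n] by (simp add: cut_def)
  have "tile_region (tile w) \<subseteq> tile_region (tile [ANM]) \<longleftrightarrow> w \<in> Cons ANM ` UNIV"
    if "w \<in> cut (\<rho> ^ Suc n)" for w
  proof (cases w)
    case Nil
    then show ?thesis using that Nil_notin by simp
  next
    case (Cons d v)
    then show ?thesis
      using tile_region_Cons[of ANM v] tile_region_not_subset[of d ANM v] by auto
  qed
  then have "{t \<in> tile ` cut (\<rho> ^ Suc n). tile_region t \<subseteq> tile_region (tile [ANM])} =
      tile ` (cut (\<rho> ^ Suc n) \<inter> Cons ANM ` UNIV)"
    by blast
  also have "cut (\<rho> ^ Suc n) \<inter> Cons ANM ` UNIV = Cons ANM ` cut (\<rho> ^ n)"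
    using cut_Cons_ANM[of _ n] by blast
  finally show ?thesis
    by (simp only: subdivision_rank[OF power_in_range] image_image)
qed

text \<open>The daughter \<open>CFB\<close> keeps the vertex \<open>B\<close>, so a chain of such
  steps leads to a tile at \<open>B\<close>, which inflation carries arbitrarily far.\<close>

lemma place_word_CFB: "place_word (replicate k CFB) (Complex b a) = Complex b a"
proof (induction k)
  case (Suc k)
  have "place CFB (Complex b a) = Complex b a"
    using tile_singleton(5) by (simp add: tile_def basic_tile_def)
  then show ?case using Suc by simp
qed simp

text \<open>The daughter \<open>ANM\<close> shares the vertex \<open>A = 0\<close> with its parent, so inflating about \<open>0\<close>
  nests the supertiles.\<close>

lemma hierarchical_tiling_exists: "\<exists>X. hierarchical_tiling a b X"
proof -
  \<comment> \<open>With this threshold, the largest tiles of the supertile have hypotenuse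
    \<open>c\<close> again after \<open>i\<close> inflations.\<close>
  define N where "N i = rank (\<rho> ^ i)" for i
  define S where "S i = map_tile (grow ^^ i) ` subdivision a b (N i)" for i
  have sim: "similarity (grow ^^ i)" for i by (rule similarity_funpow[OF similarity_grow])
  have S_eq: "S i = (\<lambda>w. map_tile (grow ^^ i) (tile w)) ` cut (\<rho> ^ i)" for i
    unfolding S_def N_def subdivision_rank[OF power_in_range] by (simp add: image_image)
  have "N i < N (Suc i)" for i
  proof -
    have "\<rho> ^ Suc i < \<rho> ^ i" using \<rho>_pos \<rho>_less_1 by simp
    let ?A = "{x \<in> range size_of. \<rho> ^ i < x}" and ?B = "{x \<in> range size_of. \<rho> ^ Suc i < x}"
    have "?A \<subseteq> ?B" using \<open>\<rho> ^ Suc i < \<rho> ^ i\<close> by auto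
    moreover have "\<rho> ^ i \<in> ?B" "\<rho> ^ i \<notin> ?A"
      using \<open>\<rho> ^ Suc i < \<rho> ^ i\<close> power_in_range[of i] by auto
    ultimately have "?A \<subset> ?B" by (metis psubsetI)
    then show ?thesis
      unfolding N_def rank_def using \<rho>_pos by (intro psubset_card_mono finite_sizes_gt) simp
  qed
  then have N: "strict_mono N" by (simp add: strict_mono_Suc_iff)
  have step: "S i = map_tile (grow ^^ Suc i) `
      {t \<in> subdivision a b (N (Suc i)). tile_region t \<subseteq> tile_region (tile [ANM])}" for i
  proof -
    have "grow ^^ Suc i \<circ> place ANM = grow ^^ i"
      unfolding funpow_Suc_right comp_assoc grow_place_ANM by simp
    then show ?thesis
      unfolding N_def cut_sub_ANM S_eq by (simp only: image_image tile_Cons map_tile_comp)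
  qed
  \<comment> \<open>The tile at the end of this chain lies outside \<open>ANM\<close>, which gives
    strict inclusion, and contains \<open>B\<close>, which gives unboundedness.\<close>
  have CFB: "\<exists>k>0. replicate k CFB \<in> cut (\<rho> ^ Suc i)" for i
    using ex_extension_in_cut[of "\<rho> ^ Suc i" "[]"] \<rho>_pos \<rho>_power_Suc[of i] by auto
  have strict: "S i \<subset> S (Suc i)" for i
  proof -
    obtain k where k: "k > 0" "replicate k CFB \<in> cut (\<rho> ^ Suc i)" using CFB by blast
    then obtain v where v: "replicate k CFB = CFB # v" by (cases k) auto
    let ?t = "tile (CFB # v)"
    have "?t \<in> subdivision a b (N (Suc i))"
      using k(2) unfolding N_def subdivision_rank[OF power_in_range] v by blast
    moreover have "\<not> tile_region ?t \<subseteq> tile_region (tile [ANM])"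
      by (rule tile_region_not_subset) simp
    ultimately have "map_tile (grow ^^ Suc i) ?t \<in> S (Suc i)" "map_tile (grow ^^ Suc i) ?t \<notin> S i"
      using inj_image_mem_iff[OF inj_map_tile[OF similarity_inj[OF sim[of "Suc i"]]]]
      unfolding step[of i] S_def[of "Suc i"] by blast+
    moreover have "S i \<subseteq> S (Suc i)" unfolding step[of i] S_def[of "Suc i"] by blast
    ultimately show ?thesis by blast
  qed
  have mono: "mono S" using strict by (intro mono_iff_le_Suc[THEN iffD2]) blast
  have disjoint: "interior (tile_region t) \<inter> interior (tile_region t') = {}"
    if tt: "t \<in> S i" "t' \<in> S i" "t \<noteq> t'" for t t' i
  proof -
    obtain v w where vw: "v \<in> cut (\<rho> ^ i)" "w \<in> cut (\<rho> ^ i)"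
      "t = map_tile (grow ^^ i) (tile v)" "t' = map_tile (grow ^^ i) (tile w)"
      using tt unfolding S_eq by blast
    then have "interior (tile_region (tile v)) \<inter> interior (tile_region (tile w)) = {}"
      using tt(3) by (intro disjoint_interiors_cut) auto
    then show ?thesis
      unfolding vw(3,4) tile_region_map_tile[OF sim] interior_similarity[OF sim]
      by (simp add: image_Int[OF similarity_inj[OF sim], symmetric])
  qed
  have "pairwise (\<lambda>t t'. interior (tile_region t) \<inter> interior (tile_region t') = {}) (\<Union>i. S i)"
  proof (rule pairwiseI)
    fix t t' assume "t \<in> (\<Union>i. S i)" "t' \<in> (\<Union>i. S i)" "t \<noteq> t'"
    then obtain i j where "t \<in> S i" "t' \<in> S j" by blast
    then have "t \<in> S (max i j)" "t' \<in> S (max i j)"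
      using monoD[OF mono, of i "max i j"] monoD[OF mono, of j "max i j"] by auto
    then show "interior (tile_region t) \<inter> interior (tile_region t') = {}"
      using disjoint \<open>t \<noteq> t'\<close> by blast
  qed
  moreover have "\<not> bounded (\<Union>t\<in>(\<Union>i. S i). tile_region t)"
  proof
    assume "bounded (\<Union>t\<in>(\<Union>i. S i). tile_region t)"
    then obtain M where M: "norm x \<le> M" if "t \<in> S i" "x \<in> tile_region t" for x t i
      unfolding bounded_iff by blast
    have "norm (Complex b a) / \<rho> ^ Suc i \<le> M" for i
    proof -
      obtain k where k: "replicate k CFB \<in> cut (\<rho> ^ Suc i)" using CFB by blast
      have "Complex b a \<in> tile_region T" by (simp add: basic_tile_def hull_inc)
      then have "place_word (replicate k CFB) (Complex b a) \<in> tile_region (tile (replicate k CFB))"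
        using tile_region_append[of "replicate k CFB" "[]"] by simp
      then have "Complex b a \<in> tile_region (tile (replicate k CFB))"
        unfolding place_word_CFB .
      then have "(grow ^^ Suc i) (Complex b a) \<in>
          tile_region (map_tile (grow ^^ Suc i) (tile (replicate k CFB)))"
        unfolding tile_region_map_tile[OF sim] by (rule imageI)
      moreover have "map_tile (grow ^^ Suc i) (tile (replicate k CFB)) \<in> S (Suc i)"
        unfolding S_eq using k by blast
      ultimately show ?thesis using M norm_grow by metis
    qed
    then have "norm (Complex b a) * (1 / \<rho>) ^ Suc i \<le> M" for i
      by (simp add: power_one_over)
    moreover obtain i where "M / norm (Complex b a) < (1 / \<rho>) ^ i"
      using real_arch_pow[of "1 / \<rho>"] \<rho>_pos \<rho>_less_1 by auto
    moreover have "(1 / \<rho>) ^ i \<le> (1 / \<rho>) ^ Suc i"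
      using \<rho>_pos \<rho>_less_1 by (intro power_increasing) auto
    moreover have "norm (Complex b a) > 0" using pos by (auto simp: complex_eq_iff)
    ultimately show False
      by (smt (verit, best) pos_divide_less_eq mult.commute)
  qed
  moreover have "supertile a b (N i) (S i)" for i
    unfolding supertile_def S_def using sim[of i] unfolding similarity_iff_motion_rescaling by metis
  moreover have "\<exists>e s. euclidean_motion e \<and> rescaling s \<and>
        S (Suc i) = map_tile (e \<circ> s) ` subdivision a b (N (Suc i)) \<and>
        (\<exists>n\<le>N (Suc i). \<exists>t\<in>subdivision a b n.
          S i = map_tile (e \<circ> s) `
            {t' \<in> subdivision a b (N (Suc i)). tile_region t' \<subseteq> tile_region t})" for i
  proof -
    obtain e s where es: "euclidean_motion e" "rescaling s" "grow ^^ Suc i = e \<circ> s"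
      using sim[of "Suc i"] unfolding similarity_iff_motion_rescaling by blast
    have "daughters T = range (\<lambda>d. tile [d])" using daughters_tile[of "[]"] by simp
    \<comment> \<open>The first step subdivides the single root tile, so \<open>n = 1\<close> and
      the daughter \<open>ANM\<close> serve as witnesses.\<close>
    then have ANM: "tile [ANM] \<in> subdivision a b 1" by (simp add: subdivision_def subdivide_largest_def)
    show ?thesis
    proof (intro exI conjI)
      show "S (Suc i) = map_tile (e \<circ> s) ` subdivision a b (N (Suc i))"
        unfolding es(3)[symmetric] by (rule S_def)
      show "1 \<le> N (Suc i)" using strict_mono_imp_increasing[OF N, of "Suc i"] by linarith
      show "\<exists>t\<in>subdivision a b 1. S i = map_tile (e \<circ> s) `
          {t' \<in> subdivision a b (N (Suc i)). tile_region t' \<subseteq> tile_region t}"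
        unfolding es(3)[symmetric] using step[of i] ANM by (rule bexI)
    qed (rule es)+
  qed
  ultimately have "hierarchical_tiling a b (\<Union>i. S i)"
    unfolding hierarchical_tiling_def tiling_of_infinite_region_def
    using N strict by (intro conjI exI[of _ S] exI[of _ N]) blast+
  then show ?thesis ..
qed

section \<open>Equal legs in terms of the angle and of the logarithms\<close>

lemma \<sigma>_cubed_iff: "\<sigma> ^ 3 = \<rho> \<longleftrightarrow> a = b"
proof
  assume "\<sigma> ^ 3 = \<rho>"
  \<comment> \<open>With \<open>\<rho> = \<sigma> ^ 3\<close> the Pythagorean relation becomes a
    cubic in \<open>\<sigma>\<^sup>2\<close>; it has the root \<open>1 / 2\<close> and a positive
    quadratic cofactor.\<close>
  then have "\<sigma>\<^sup>2 + 4 * (\<sigma>\<^sup>2) ^ 3 = 1"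
    using \<sigma>_\<rho> by (metis mult.commute power_mult)
  moreover have "s + 4 * s ^ 3 - 1 = (2 * s - 1) * (2 * s\<^sup>2 + s + 1)" for s :: real
    by (simp add: power2_eq_square power3_eq_cube algebra_simps)
  ultimately have "(2 * \<sigma>\<^sup>2 - 1) * (2 * (\<sigma>\<^sup>2)\<^sup>2 + \<sigma>\<^sup>2 + 1) = 0"
    by (metis diff_self)
  moreover have "2 * (\<sigma>\<^sup>2)\<^sup>2 + \<sigma>\<^sup>2 + 1 > 0" using \<sigma>_pos by (intro add_pos_pos) auto
  ultimately have "2 * \<sigma>\<^sup>2 = 1" by (metis eq_iff_diff_eq_0 less_irrefl mult_eq_0_iff)
  then have "\<sigma>\<^sup>2 = (2 * \<rho>)\<^sup>2" using \<sigma>_\<rho> by (simp add: power_mult_distrib)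
  then have "\<sigma> = 2 * \<rho>" by (rule power2_eq_imp_eq) (use \<sigma>_pos \<rho>_pos in auto)
  then show "a = b" using pos by (simp add: \<sigma>_def \<rho>_def)
next
  assume "a = b"
  then have "\<sigma> = 2 * \<rho>" unfolding \<sigma>_def \<rho>_def by simp
  then show "\<sigma> ^ 3 = \<rho>" using \<sigma>_\<rho> by (simp add: power3_eq_cube power2_eq_square power_mult_distrib)
qed

lemma sin_arcsin_ratio: "sin (arcsin (a / c)) = \<sigma>" and cos_arcsin_ratio: "cos (arcsin (a / c)) = 2 * \<rho>"
proof -
  have bounds: "- 1 \<le> a / c" "a / c \<le> 1" using \<sigma>_pos \<sigma>_less_1 unfolding \<sigma>_def by linarith+
  then show "sin (arcsin (a / c)) = \<sigma>" unfolding \<sigma>_def by (rule sin_arcsin)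
  have "1 - (a / c)\<^sup>2 = (2 * \<rho>)\<^sup>2" using \<sigma>_\<rho> by (simp add: \<sigma>_def power_mult_distrib)
  then show "cos (arcsin (a / c)) = 2 * \<rho>" using cos_arcsin[OF bounds] real_sqrt_abs[of "2 * \<rho>"] \<rho>_pos by simp
qed

lemma arcsin_eq_pi_4_iff: "arcsin (a / c) = pi / 4 \<longleftrightarrow> a = b"
proof
  assume "arcsin (a / c) = pi / 4"
  then have "\<sigma> = sqrt 2 / 2" using sin_arcsin_ratio by (metis sin_45)
  then have "\<sigma>\<^sup>2 = 1 / 2" by (simp add: power_divide del: eq_divide_eq_numeral1)
  then have "\<sigma>\<^sup>2 = (2 * \<rho>)\<^sup>2" using \<sigma>_\<rho> by (simp add: power_mult_distrib)
  then have "\<sigma> = 2 * \<rho>" by (rule power2_eq_imp_eq) (use \<sigma>_pos \<rho>_pos in auto)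
  then show "a = b" using pos by (simp add: \<sigma>_def \<rho>_def)
next
  assume "a = b"
  then have "\<sigma> = 2 * \<rho>" unfolding \<sigma>_def \<rho>_def by simp
  then have "\<sigma>\<^sup>2 = (sqrt 2 / 2)\<^sup>2" using \<sigma>_\<rho> by (simp add: power_mult_distrib power_divide)
  then have "\<sigma> = sqrt 2 / 2" by (rule power2_eq_imp_eq) (use \<sigma>_pos in auto)
  then have "a / c = sin (pi / 4)" by (simp add: \<sigma>_def sin_45)
  then show "arcsin (a / c) = pi / 4" by (simp add: arcsin_sin)
qed

lemma ln_ratio_iff: "ln (sin (arcsin (a / c))) / ln (cos (arcsin (a / c)) / 2) = 1 / 3 \<longleftrightarrow> a = b"
proof -
  have "ln \<sigma> / ln \<rho> = 1 / 3 \<longleftrightarrow> \<sigma> ^ 3 = \<rho>"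
  proof -
    have "ln \<rho> < 0" using \<rho>_pos \<rho>_less_1 by simp
    then have "ln \<sigma> / ln \<rho> = 1 / 3 \<longleftrightarrow> ln (\<sigma> ^ 3) = ln \<rho>"
      using \<sigma>_pos by (auto simp: ln_realpow field_simps)
    then show ?thesis using \<sigma>_pos \<rho>_pos by simp
  qed
  then show ?thesis using \<sigma>_cubed_iff by (simp add: sin_arcsin_ratio cos_arcsin_ratio)
qed

end

text \<open>Existence of a hierarchical tiling for every angle keeps the universal clause from
  holding vacuously and supplies the witness for the existential one.\<close>

theorem theorem4:
  fixes a b c \<theta> :: real
  assumes "a > 0" and "b > 0" and "c > 0"
    and "a\<^sup>2 + b\<^sup>2 = c\<^sup>2"
    and "\<theta> = arcsin (a / c)"
  shows "(gives_rise_to a b (\<lambda>X. finitely_many_orientations a b X \<and> finitely_many_sizes X)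
            \<longleftrightarrow> \<theta> = pi / 4) \<and>
         ((\<exists>X. hierarchical_tiling a b X \<and> finitely_many_orientations a b X \<and> finitely_many_sizes X)
            \<longleftrightarrow> \<theta> = pi / 4) \<and>
         (ln (sin \<theta>) / ln (cos \<theta> / 2) = 1 / 3 \<longleftrightarrow> \<theta> = pi / 4)"
proof -
  interpret right_triangle a b c using assms by unfold_locales
  show ?thesis
    unfolding assms(5) arcsin_eq_pi_4_iff ln_ratio_iff gives_rise_to_def
    using isosceles_if_finite finite_if_isosceles hierarchical_tiling_exists by blast
qed

end
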